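(* Let $\tau\in(0,\frac{1+\sqrt5}{2})$ and let $\{(y^k,z^k,x^k)\}$ be a sequence generated by the sPADMM with dual step-size $\tau$ (as described in the context). For each $k\ge 1$, let $\alpha_i\ge 0$ for $i=1,2,\ldots,k+1$ be such that $\alpha_1=0$ and $\sum_{i=1}^{k}\alpha_{i+1}=1$, and define $$\overline{y}^{k}=\sum_{i=1}^{k}\alpha_{i+1}y^{i+1},\qquad \overline{z}^{k}=\sum_{i=1}^{k}\alpha_{i+1}z^{i+1},\qquad \overline{x}^{k}=\sum_{i=1}^{k}\alpha_{i+1}\widetilde{x}^{i+1},$$ $$\overline{\epsilon}_{y}^{k}=\sum_{i=1}^{k}\alpha_{i+1}\langle y^{i+1}-\overline{y}^{k},\,\delta_{y}^{i+1}-\mathcal{A}\widetilde{x}^{i+1}\rangle\quad\text{with } \delta_{y}^{i+1}=\mathcal{S}(y^{i}-y^{i+1}),$$ $$\overline{\epsilon}_{z}^{k}=\sum_{i=1}^{k}\alpha_{i+1}\langle z^{i+1}-\overline{z}^{k},\,\delta_{z}^{i+1}-\mathcal{B}\widetilde{x}^{i+1}\rangle\quad\text{with } \delta_{z}^{i+1}=(\mathcal{T}+\beta\mathcal{B}\mathcal{B}^* )(z^{i}-z^{i+1}).$$ Then for each $k\ge 1$ we have $\overline{\epsilon}_{y}^{k}\ge 0$, $\overline{\epsilon}_{z}^{k}\ge 0$, $$\overline{\epsilon}_{y}^{k}+\overline{\epsilon}_{z}^{k}\le 2(d^*+d_1+\eta_1)\,\frac{11-9\sigma_\tau}{1-\sigma_\tau}\sum_{i=1}^{k}|\alpha_{i+1}-\alpha_{i}|,$$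 and $$\mathrm{dist}^2\big(0,\partial_{\overline{\epsilon}_{y}^{k}}\vartheta_f(\overline{y}^{k})+\mathcal{A}\overline{x}^{k}\big)+\mathrm{dist}^2\big(0,\partial_{\overline{\epsilon}_{z}^{k}}\varphi_g(\overline{z}^{k})+\mathcal{B}\overline{x}^{k}\big)+\|\mathcal{A}^*\overline{y}^{k}+\mathcal{B}^*\overline{z}^{k}-c\|^2$$ $$\le\Big(2\sqrt{\|\mathcal{G}\|(d^*+d_1+\eta_1)}+\|\mathcal{G}(\widehat{w}^{*})\|\Big)^2\Big(\sum_{i=1}^{k}|\alpha_{i+1}-\alpha_{i}|+\alpha_{k+1}\Big)^2.$$
   Context: Setting. $\mathbb{Y},\mathbb{Z},\mathbb{X}$ are real finite-dimensional Euclidean spaces with inner product $\langle\cdot,\cdot\rangle$ and induced norm $\|\cdot\|$; $\mathbb{H}:=\mathbb{Y}\times\mathbb{Z}\times\mathbb{X}$ with the product inner product. $\vartheta:\mathbb{Y}\to(-\infty,+\infty]$ and $\varphi:\mathbb{Z}\to(-\infty,+\infty]$ are closed proper convex, $f:\mathbb{Y}\to\mathbb{R}$ and $g:\mathbb{Z}\to\mathbb{R}$ are continuously differentiable convex; $\vartheta_f:=\vartheta+f$, $\varphi_g:=\varphi+g$. $\mathcal{A}:\mathbb{X}\to\mathbb{Y}$, $\mathcal{B}:\mathbb{X}\to\mathbb{Z}$ are linear with adjoints $\mathcal{A}^*,\mathcal{B}^*$, and $c\in\mathbb{X}$. The problem is $\min\{\vartheta(y)+f(y)+\varphi(z)+g(z):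 \mathcal{A}^*y+\mathcal{B}^*z=c\}$. For $\beta>0$, the augmented Lagrangian is $L_\beta(y,z;x):=\vartheta_f(y)+\varphi_g(z)+\langle x,\mathcal{A}^*y+\mathcal{B}^*z-c\rangle+\frac{\beta}{2}\|\mathcal{A}^*y+\mathcal{B}^*z-c\|^2$. Notation. For a self-adjoint positive semidefinite linear operator $\mathcal{E}$: $\|w\|_{\mathcal{E}}:=\sqrt{\langle w,\mathcal{E}w\rangle}$ and $D_{\mathcal{E}}(w,w'):=\frac12\|w-w'\|_{\mathcal{E}}^2$. $\mathrm{dist}(\cdot,\cdot)$ is the distance in the norm $\|\cdot\|$. $\|\mathcal{G}\|$ is the spectral norm. $\mathcal{I}$ is the identity. For $\epsilon\ge0$, $\partial_\epsilon h(y)$ denotes the $\epsilon$-subdifferential of a convex function $h$ at $y$, i.e. $\{v: h(y')\ge h(y)+\langle v,y'-y\rangle-\epsilon\ \forall y'\}$. sPADMM. Fix $\beta>0$, $\tau>0$, and self-adjoint positive semidefinite $\mathcal{S}:\mathbb{Y}\to\mathbb{Y}$, $\mathcal{T}:\mathbb{Z}\to\mathbb{Z}$ such that the subproblems below are well defined (have solutions). From $(y^0,z^0,x^0)\in\mathrm{dom}\,\vartheta\times\mathrm{dom}\,\varphi\times\mathbb{X}$, for $k=0,1,2,\ldots$: $y^{k+1}\in\arg\min_{y}\{L_\beta(y,z^k;x^k)+\frac12\|y-y^k\|_{\mathcal{S}}^2\}$, $z^{k+1}\in\arg\min_{z}\{L_\beta(y^{k+1},z;x^k)+\frac12\|z-z^k\|_{\mathcal{T}}^2\}$,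 $x^{k+1}=x^k+\tau\beta(\mathcal{A}^*y^{k+1}+\mathcal{B}^*z^{k+1}-c)$. Operators. $T:\mathbb{H}\rightrightarrows\mathbb{H}$, $T(y,z,x):=(\partial\vartheta_f(y)+\mathcal{A}x)\times(\partial\varphi_g(z)+\mathcal{B}x)\times\{c-\mathcal{A}^*y-\mathcal{B}^*z\}$. $T^{-1}(0)=\{w:0\in T(w)\}$ is the set of KKT points of the problem; it is assumed nonempty. $\Sigma_{\vartheta_f}$ and $\Sigma_{\varphi_g}$ are fixed self-adjoint positive semidefinite linear operators such that $\langle\xi'-\xi,y'-y\rangle\ge\|y'-y\|^2_{\Sigma_{\vartheta_f}}$ for all $y',y\in\mathrm{dom}\,\vartheta_f$, $\xi'\in\partial\vartheta_f(y')$, $\xi\in\partial\vartheta_f(y)$, and $\langle\eta'-\eta,z'-z\rangle\ge\|z'-z\|^2_{\Sigma_{\varphi_g}}$ for all $z',z\in\mathrm{dom}\,\varphi_g$, $\eta'\in\partial\varphi_g(z')$, $\eta\in\partial\varphi_g(z)$. Put $\Sigma:=\mathrm{Diag}(\Sigma_{\vartheta_f},\Sigma_{\varphi_g},0)$, $\mathcal{G}:=\mathrm{Diag}(\mathcal{S},\ \mathcal{T}+\beta\mathcal{B}\mathcal{B}^*,\ (\tau\beta)^{-1}\mathcal{I})$, $\mathcal{M}:=\mathcal{G}+\Sigma$. Constants. $\sigma_\tau:=\max\{\frac{2-\tau}{2},\frac{1+\tau(\tau-1)^2}{2-(1-\tau)^2}\}$ and $\nu_\tau:=\sigma_\tau(\tau+1)+\tau-1$.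 Sequences. $w^k:=(y^k,z^k,x^k)$ for $k\ge0$. For $k\ge1$: $\widetilde{x}^k:=x^{k-1}+\beta(\mathcal{A}^*y^k+\mathcal{B}^*z^{k-1}-c)$, and $\eta_k:=\widetilde{\eta}_k+\frac14\|w^k-w^{k-1}\|_\Sigma^2$ with $\widetilde{\eta}_k:=\frac{(\sigma_\tau-(\tau-1)^2)\beta}{2\tau}\|\mathcal{A}^*y^k+\mathcal{B}^*z^k-c\|^2+\frac{\sigma_\tau}{2}\|y^k-y^{k-1}\|_{\mathcal{S}}^2+\frac{\nu_\tau}{2\tau}\|z^k-z^{k-1}\|_{\mathcal{T}}^2+\frac{\sigma_\tau+\tau-1}{\tau}\|z^k-z^{k-1}\|_{\Sigma_{\varphi_g}}^2$. Also $d^*:=\min_{w\in T^{-1}(0)}D_{\mathcal{M}}(w,w^0)=D_{\mathcal{M}}(\widehat{w}^*,w^0)$, where $\widehat{w}^*\in T^{-1}(0)$ is a point attaining this minimum, and $d_1:=D_{\mathcal{M}}(w^1,w^0)$. *)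

theory Defs
  imports "HOL-Analysis.Analysis"
begin

text \<open>
  Functions into \<open>(-\<infinity>, +\<infinity>]\<close> are modelled as \<^typ>\<open>ereal\<close>-valued functions; properness
  excludes the value \<open>-\<infinity>\<close>.
\<close>

definition epi :: "('a \<Rightarrow> ereal) \<Rightarrow> ('a \<times> real) set" where
  "epi h = {(u, r). h u \<le> ereal r}"

definition edom :: "('a \<Rightarrow> ereal) \<Rightarrow> 'a set" where
  "edom h = {u. h u < \<infinity>}"

definition proper_fun :: "('a \<Rightarrow> ereal) \<Rightarrow> bool" where
  "proper_fun h \<longleftrightarrow> (\<forall>u. h u \<noteq> -\<infinity>) \<and> edom h \<noteq> {}"

definition closed_proper_convex :: "('a::euclidean_space \<Rightarrow> ereal) \<Rightarrow> bool" where
  "closed_proper_convex h \<longleftrightarrow> closed (epi h) \<and> proper_fun h \<and> convex (epi h)"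

definition cont_diff :: "('a::euclidean_space \<Rightarrow> real) \<Rightarrow> bool" where
  "cont_diff f \<longleftrightarrow> (\<exists>df. (\<forall>u. GDERIV f u :> df u) \<and> continuous_on UNIV df)"

definition eps_subdiff :: "real \<Rightarrow> ('a::euclidean_space \<Rightarrow> ereal) \<Rightarrow> 'a \<Rightarrow> 'a set" where
  "eps_subdiff \<epsilon> h u = {v. \<forall>u'. h u' \<ge> h u + ereal (v \<bullet> (u' - u)) - ereal \<epsilon>}"

abbreviation subdiff :: "('a::euclidean_space \<Rightarrow> ereal) \<Rightarrow> 'a \<Rightarrow> 'a set" where
  "subdiff \<equiv> eps_subdiff 0"

text \<open>
  Distance to a set with the convention that the distance to the empty set is \<open>+\<infinity>\<close>
  (the library's \<^const>\<open>infdist\<close> gives \<open>0\<close> there).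
\<close>

definition edist :: "'a::metric_space \<Rightarrow> 'a set \<Rightarrow> ereal" where
  "edist a S = (INF s\<in>S. ereal (dist a s))"

definition psd_op :: "('a::euclidean_space \<Rightarrow> 'a) \<Rightarrow> bool" where
  "psd_op E \<longleftrightarrow> linear E \<and> adjoint E = E \<and> (\<forall>u. 0 \<le> u \<bullet> E u)"

definition op_norm :: "('a::euclidean_space \<Rightarrow> 'a) \<Rightarrow> 'a \<Rightarrow> real" where
  "op_norm E u = sqrt (u \<bullet> E u)"

definition op_dist :: "('a::euclidean_space \<Rightarrow> 'a) \<Rightarrow> 'a \<Rightarrow> 'a \<Rightarrow> real" where
  "op_dist E u u' = 1/2 * (op_norm E (u - u'))\<^sup>2"

definition diag_op ::
  "('y \<Rightarrow> 'y) \<Rightarrow> ('z \<Rightarrow> 'z) \<Rightarrow> ('x \<Rightarrow> 'x) \<Rightarrow> 'y \<times> 'z \<times> 'x \<Rightarrow> 'y \<times> 'z \<times> 'x" where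
  "diag_op E F H = (\<lambda>(u, v, w). (E u, F v, H w))"

definition strong_mono_with ::
  "('a::euclidean_space \<Rightarrow> ereal) \<Rightarrow> ('a \<Rightarrow> 'a) \<Rightarrow> bool" where
  "strong_mono_with h E \<longleftrightarrow>
     (\<forall>u'\<in>edom h. \<forall>u\<in>edom h. \<forall>\<xi>'\<in>subdiff h u'. \<forall>\<xi>\<in>subdiff h u.
        (\<xi>' - \<xi>) \<bullet> (u' - u) \<ge> (op_norm E (u' - u))\<^sup>2)"

text \<open>
  Below, \<open>h\<close> and \<open>p\<close> are the two (composite) objective parts, i.e.\ \<open>\<vartheta>\<^sub>f\<close> and \<open>\<phi>\<^sub>g\<close>.
\<close>

definition resid ::
  "('x::euclidean_space \<Rightarrow> 'y::euclidean_space) \<Rightarrow> ('x \<Rightarrow> 'z::euclidean_space) \<Rightarrow> 'x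
    \<Rightarrow> 'y \<Rightarrow> 'z \<Rightarrow> 'x" where
  "resid A B c y z = adjoint A y + adjoint B z - c"

definition aug_lagrangian ::
  "('y::euclidean_space \<Rightarrow> ereal) \<Rightarrow> ('z::euclidean_space \<Rightarrow> ereal)
    \<Rightarrow> ('x::euclidean_space \<Rightarrow> 'y) \<Rightarrow> ('x \<Rightarrow> 'z) \<Rightarrow> 'x \<Rightarrow> real
    \<Rightarrow> 'y \<Rightarrow> 'z \<Rightarrow> 'x \<Rightarrow> ereal" where
  "aug_lagrangian h p A B c \<beta> y z x =
     h y + p z + ereal (x \<bullet> resid A B c y z + \<beta> / 2 * (norm (resid A B c y z))\<^sup>2)"

definition spadmm_step ::
  "('y::euclidean_space \<Rightarrow> ereal) \<Rightarrow> ('z::euclidean_space \<Rightarrow> ereal)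
    \<Rightarrow> ('x::euclidean_space \<Rightarrow> 'y) \<Rightarrow> ('x \<Rightarrow> 'z) \<Rightarrow> 'x \<Rightarrow> real \<Rightarrow> real
    \<Rightarrow> ('y \<Rightarrow> 'y) \<Rightarrow> ('z \<Rightarrow> 'z) \<Rightarrow> 'y \<times> 'z \<times> 'x \<Rightarrow> 'y \<times> 'z \<times> 'x \<Rightarrow> bool" where
  "spadmm_step h p A B c \<beta> \<tau> S T = (\<lambda>(y, z, x) (y', z', x').
     is_arg_min (\<lambda>u. aug_lagrangian h p A B c \<beta> u z x + ereal (1/2 * (op_norm S (u - y))\<^sup>2))
       (\<lambda>u. True) y' \<and>
     is_arg_min (\<lambda>v. aug_lagrangian h p A B c \<beta> y' v x + ereal (1/2 * (op_norm T (v - z))\<^sup>2))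
       (\<lambda>v. True) z' \<and>
     x' = x + (\<tau> * \<beta>) *\<^sub>R resid A B c y' z')"

definition kkt_op ::
  "('y::euclidean_space \<Rightarrow> ereal) \<Rightarrow> ('z::euclidean_space \<Rightarrow> ereal)
    \<Rightarrow> ('x::euclidean_space \<Rightarrow> 'y) \<Rightarrow> ('x \<Rightarrow> 'z) \<Rightarrow> 'x
    \<Rightarrow> 'y \<times> 'z \<times> 'x \<Rightarrow> ('y \<times> 'z \<times> 'x) set" where
  "kkt_op h p A B c = (\<lambda>(y, z, x).
     (\<lambda>v. v + A x) ` subdiff h y \<times>
     (\<lambda>v. v + B x) ` subdiff p z \<times>
     {c - adjoint A y - adjoint B z})"

definition kkt_points ::
  "('y::euclidean_space \<Rightarrow> ereal) \<Rightarrow> ('z::euclidean_space \<Rightarrow> ereal)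
    \<Rightarrow> ('x::euclidean_space \<Rightarrow> 'y) \<Rightarrow> ('x \<Rightarrow> 'z) \<Rightarrow> 'x \<Rightarrow> ('y \<times> 'z \<times> 'x) set" where
  "kkt_points h p A B c = {w. 0 \<in> kkt_op h p A B c w}"

definition sigma_const :: "real \<Rightarrow> real" where
  "sigma_const \<tau> = max ((2 - \<tau>) / 2) ((1 + \<tau> * (\<tau> - 1)\<^sup>2) / (2 - (1 - \<tau>)\<^sup>2))"

definition nu_const :: "real \<Rightarrow> real" where
  "nu_const \<tau> = sigma_const \<tau> * (\<tau> + 1) + \<tau> - 1"

end

theory Submission
  imports Defs
begin

text \<open>
  Why the bounds hold. Write \<open>w\<close> for the iterates and \<open>v\<close> for the iterates whose multiplier is
  replaced by the extrapolated one. The optimality conditions of the two subproblems together with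
  the multiplier update say exactly that \<open>G (w\<^sub>i - w\<^sub>i\<^sub>+\<^sub>1)\<close> lies in the KKT operator at
  \<open>v\<^sub>i\<^sub>+\<^sub>1\<close>; the method is a proximal point iteration whose point of evaluation is inexact.

  The inexactness is controlled by a relative error inequality (\<open>relative_error\<close>),
  \<open>D_G(v\<^sub>i\<^sub>+\<^sub>1, w\<^sub>i\<^sub>+\<^sub>1) + \<eta>\<^sub>i\<^sub>+\<^sub>1 \<le> \<sigma> D_G(v\<^sub>i\<^sub>+\<^sub>1, w\<^sub>i) + \<eta>\<^sub>i\<close>,
  where the potential \<open>\<eta>\<close> pays for a step size above one. It compares two consecutive
  \<open>z\<close>-subproblems through monotonicity, which leaves a quadratic form in the last \<open>z\<close>-step and the
  residual before it. The dependence of \<open>\<sigma>\<close> on \<open>\<tau>\<close> is chosen to make this form nonnegative and to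
  keep \<open>\<sigma> < 1\<close>; for \<open>\<tau> > 1\<close> both come down to \<open>\<tau>\<close> being below the golden ratio
  (\<open>step_size_constants\<close>).

  Through the three-point identity for \<open>D_G\<close> the relative error gives, for every reference point
  \<open>u\<close>, a telescoping upper bound on \<open>\<langle>G (w\<^sub>i - w\<^sub>i\<^sub>+\<^sub>1), v\<^sub>i\<^sub>+\<^sub>1 - u\<rangle>\<close> (\<open>inner_G_step_le\<close>). For a
  KKT point \<open>u\<close> this inner product is also bounded below by monotonicity of the KKT operator, and
  \<open>D_M(u, w\<^sub>i) + \<eta>\<^sub>i\<close> does not increase (\<open>fejer\<close>). Hence all \<open>w\<^sub>i\<close> and \<open>v\<^sub>i\<close> stay in balls whose size is
  governed by the initial data.

  A convex combination of subgradients is an \<open>\<epsilon>\<close>-subgradient at the averaged point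
  (\<open>subgradient_averages\<close>). The errors \<open>\<epsilon>\<^sub>y + \<epsilon>\<^sub>z\<close> are the weighted sum of the inner products above
  with \<open>u\<close> the average of the \<open>v\<^sub>i\<close>, and the averaged residual is the weighted sum of
  \<open>G (w\<^sub>i - w\<^sub>i\<^sub>+\<^sub>1)\<close>. In both sums summation by parts moves the differences from the iterates to the
  weights, and the a priori bounds give the two estimates.
\<close>

section \<open>Positive semidefinite operators and their Bregman distances\<close>

lemma psd_opI:
  assumes "linear E" and sym: "\<And>u v. u \<bullet> E v = E u \<bullet> v" and "\<And>u. 0 \<le> u \<bullet> E u"
  shows "psd_op E"
proof -
  have "adjoint E = E"
    by (rule adjoint_unique) (simp add: sym)
  with assms show ?thesis by (simp add: psd_op_def)
qed

lemma
  assumes "psd_op E"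
  shows psd_op_linear: "linear E"
    and psd_op_nonneg: "0 \<le> u \<bullet> E u"
    and psd_op_sym: "u \<bullet> E v = v \<bullet> E u"
    and op_norm_sq: "(op_norm E u)\<^sup>2 = u \<bullet> E u"
  using assms adjoint_works[of E u v]
  by (auto simp: psd_op_def op_norm_def inner_commute)

lemma psd_op_diag:
  assumes "psd_op E" "psd_op F" "psd_op H"
  shows "psd_op (diag_op E F H)"
proof (rule psd_opI)
  note lin = assms[THEN psd_op_linear]
  show "linear (diag_op E F H)"
    by (rule linearI) (auto simp: diag_op_def linear_add[OF lin(1)] linear_add[OF lin(2)]
        linear_add[OF lin(3)] linear_scale[OF lin(1)] linear_scale[OF lin(2)] linear_scale[OF lin(3)])
next
  fix u v
  show "u \<bullet> diag_op E F H v = diag_op E F H u \<bullet> v"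
    using psd_op_sym[OF assms(1), of "fst u" "fst v"] psd_op_sym[OF assms(2), of "fst (snd u)" "fst (snd v)"]
      psd_op_sym[OF assms(3), of "snd (snd u)" "snd (snd v)"]
    by (cases u rule: prod_cases3; cases v rule: prod_cases3) (simp add: diag_op_def inner_commute)
  show "0 \<le> u \<bullet> diag_op E F H u"
    by (auto simp: diag_op_def inner_prod_def psd_op_nonneg[OF assms(1)] psd_op_nonneg[OF assms(2)]
        psd_op_nonneg[OF assms(3)] split: prod.splits)
qed

lemma psd_op_add:
  assumes "psd_op E" "psd_op F"
  shows "psd_op (\<lambda>u. E u + F u)"
  using assms[THEN psd_op_linear] assms[THEN psd_op_nonneg]
    psd_op_sym[OF assms(1)] psd_op_sym[OF assms(2)]
  by (intro psd_opI linear_compose_add) (auto simp: inner_add inner_commute)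

lemma psd_op_scale:
  assumes "r \<ge> 0"
  shows "psd_op (\<lambda>u. r *\<^sub>R u)"
  using assms by (intro psd_opI linear_scaleR) auto

lemma psd_op_gram:
  fixes B :: "'x::euclidean_space \<Rightarrow> 'z::euclidean_space"
  assumes "linear B" "b \<ge> 0"
  shows "psd_op (\<lambda>v. b *\<^sub>R B (adjoint B v))"
proof (rule psd_opI)
  show "linear (\<lambda>v. b *\<^sub>R B (adjoint B v))"
    using linear_compose[OF adjoint_linear[OF assms(1)] assms(1)]
    by (intro linear_compose_scale_right) (simp add: o_def)
next
  have gram: "u \<bullet> B (adjoint B v) = adjoint B u \<bullet> adjoint B v" for u v
    using adjoint_works[OF assms(1), of "adjoint B v" u] by (simp add: inner_commute)
  show "u \<bullet> b *\<^sub>R B (adjoint B v) = b *\<^sub>R B (adjoint B u) \<bullet> v" for u v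
    using gram[of u v] gram[of v u] by (simp add: inner_commute)
  show "0 \<le> u \<bullet> b *\<^sub>R B (adjoint B u)" for u
    using assms(2) gram[of u u] by simp
qed

lemma op_dist_inner: "psd_op E \<Longrightarrow> op_dist E u v = (u - v) \<bullet> E (u - v) / 2"
  by (simp add: op_dist_def op_norm_sq)

lemma op_dist_nonneg: "0 \<le> op_dist E u v"
  by (simp add: op_dist_def)

lemma op_dist_commute:
  assumes "psd_op E" shows "op_dist E u v = op_dist E v u"
  using linear_neg[OF psd_op_linear[OF assms], of "u - v"]
  by (simp add: op_dist_inner[OF assms]) (metis inner_minus_left inner_minus_right minus_diff_eq minus_minus)

lemma op_dist_three_point:
  assumes E: "psd_op E"
  shows "E (a - b) \<bullet> (v - u) = op_dist E u a - op_dist E u b + op_dist E v b - op_dist E v a"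
proof -
  note [simp] = linear_diff[OF psd_op_linear[OF E]]
  show ?thesis
    using psd_op_sym[OF E, of a u] psd_op_sym[OF E, of b u]
      psd_op_sym[OF E, of a v] psd_op_sym[OF E, of b v]
    by (simp add: op_dist_inner[OF E] inner_diff inner_commute[of "E _"] field_simps)
qed

lemma op_dist_triangle:
  assumes E: "psd_op E"
  shows "op_dist E a c \<le> 2 * op_dist E a b + 2 * op_dist E b c"
proof -
  define s t where "s = a - b" and "t = b - c"
  have ac: "a - c = s + t" by (simp add: s_def t_def)
  note lin = psd_op_linear[OF E]
  have "0 \<le> (s - t) \<bullet> E (s - t)"
    by (rule psd_op_nonneg[OF E])
  then have "(s + t) \<bullet> E (s + t) \<le> 2 * (s \<bullet> E s) + 2 * (t \<bullet> E t)"
    by (simp add: linear_diff[OF lin] linear_add[OF lin] inner_diff_left inner_diff_right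
        inner_add_left inner_add_right)
  then show ?thesis
    by (simp add: op_dist_inner[OF E] ac flip: s_def t_def)
qed

text \<open>
  Expanding each distance to \<open>v\<close> around the mean \<open>m\<close> by the three-point identity, the linear terms
  cancel in the weighted sum, so the distance of \<open>m\<close> to \<open>v\<close> is at most the average of the distances.
\<close>

lemma op_dist_convex_comb_le:
  assumes E: "psd_op E" and "\<And>i. i \<in> I \<Longrightarrow> 0 \<le> a i" and one: "sum a I = 1"
    and le: "\<And>i. i \<in> I \<Longrightarrow> op_dist E (u i) v \<le> K"
  shows "op_dist E (\<Sum>i\<in>I. a i *\<^sub>R u i) v \<le> K"
proof -
  define m where "m = (\<Sum>i\<in>I. a i *\<^sub>R u i)"
  have "(\<Sum>i\<in>I. a i *\<^sub>R (u i - m)) = 0"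
    using one by (simp add: scaleR_diff_right sum_subtractf flip: scaleR_left.sum) (simp add: m_def)
  then have "0 = E (v - m) \<bullet> (\<Sum>i\<in>I. a i *\<^sub>R (u i - m))"
    by simp
  also have "\<dots> = (\<Sum>i\<in>I. a i * (E (v - m) \<bullet> (u i - m)))"
    by (simp add: inner_sum_right)
  also have "\<dots> = (\<Sum>i\<in>I. a i * (op_dist E m v - op_dist E m m + op_dist E (u i) m - op_dist E (u i) v))"
    by (simp only: op_dist_three_point[OF E])
  also have "\<dots> \<ge> (\<Sum>i\<in>I. a i * (op_dist E m v - K))"
    using le assms(2) op_dist_nonneg[of E]
    by (intro sum_mono mult_left_mono)
      (auto simp: op_dist_inner[OF E, of m m] algebra_simps add_increasing2)
  finally show ?thesis
    using one by (simp add: m_def flip: sum_distrib_right)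
qed

text \<open>
  The form of \<open>E\<close> is nonnegative at \<open>onorm E *\<^sub>R u - E u\<close>, and its value on \<open>E u\<close> is at most
  \<open>onorm E * (norm (E u))\<^sup>2\<close>; this gives the claim without a square root of \<open>E\<close>.
\<close>

lemma norm_psd_op_le:
  assumes E: "psd_op E"
  shows "(norm (E u))\<^sup>2 \<le> onorm E * (u \<bullet> E u)"
proof (cases "E u = 0")
  case False
  note lin = psd_op_linear[OF E]
  have bl: "bounded_linear E"
    using lin by (simp add: linear_conv_bounded_linear)
  define v where "v = E u"
  define s where "s = v \<bullet> v"
  have vv: "v \<bullet> E v \<le> onorm E * s"
  proof -
    have "v \<bullet> E v \<le> norm v * norm (E v)" by (rule norm_cauchy_schwarz)
    also have "\<dots> \<le> norm v * (onorm E * norm v)"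
      by (intro mult_left_mono onorm bl) auto
    finally show ?thesis by (simp add: s_def dot_square_norm power2_eq_square mult_ac)
  qed
  have s: "s > 0" "u \<bullet> E v = s" "v \<bullet> E u = s"
    using False psd_op_sym[OF E, of u v] by (auto simp: s_def v_def)
  have on: "onorm E \<ge> 0" by (rule onorm_pos_le[OF bl])
  have "0 \<le> (onorm E *\<^sub>R u - v) \<bullet> E (onorm E *\<^sub>R u - v)"
    by (rule psd_op_nonneg[OF E])
  also have "\<dots> = (onorm E)\<^sup>2 * (u \<bullet> E u) - 2 * onorm E * s + v \<bullet> E v"
    using s by (simp add: linear_diff[OF lin] linear_scale[OF lin] inner_diff power2_eq_square algebra_simps)
  also have "\<dots> \<le> onorm E * (onorm E * (u \<bullet> E u) - s)"
    using vv by (simp add: power2_eq_square algebra_simps)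
  finally have *: "0 \<le> onorm E * (onorm E * (u \<bullet> E u) - s)" .
  have "onorm E > 0"
    using False on onorm[OF bl, of u] by (cases "onorm E = 0") auto
  with * have "0 \<le> onorm E * (u \<bullet> E u) - s"
    by (simp add: zero_le_mult_iff)
  then show ?thesis by (simp add: s_def v_def dot_square_norm)
qed (simp add: onorm_pos_le)

section \<open>Subgradients of extended-real convex functions\<close>

text \<open>
  If \<open>h u = \<infinity>\<close>, the subgradient inequality would force \<open>h\<close> to be infinite everywhere.
\<close>

lemma eps_subdiff_finite:
  assumes "proper_fun h" "v \<in> eps_subdiff e h u"
  obtains r where "h u = ereal r"
proof -
  obtain u' where u': "h u' < \<infinity>"
    using assms(1) by (auto simp: proper_fun_def edom_def)
  have "h u \<noteq> -\<infinity>" using assms(1) by (simp add: proper_fun_def)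
  moreover have "h u \<noteq> \<infinity>"
  proof
    assume "h u = \<infinity>"
    then have "h u' \<ge> \<infinity>"
      using assms(2) unfolding eps_subdiff_def
      by (metis (mono_tags, lifting) ereal_minus(4) mem_Collect_eq plus_ereal.simps(2)) 
    with u' show False by simp
  qed
  ultimately show ?thesis using that by (cases "h u") auto
qed

lemma convex_epi_add:
  assumes "convex (epi h)" "convex_on UNIV f" "proper_fun h"
  shows "convex (epi (\<lambda>u. h u + ereal (f u)))"
proof (rule convexI)
  fix P Q :: "'a \<times> real" and s t :: real
  assume P: "P \<in> epi (\<lambda>u. h u + ereal (f u))" and Q: "Q \<in> epi (\<lambda>u. h u + ereal (f u))"
    and st: "0 \<le> s" "0 \<le> t" "s + t = 1"
  obtain a r where P_eq: "P = (a, r)" by force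
  obtain b q where Q_eq: "Q = (b, q)" by force
  have in_epi: "(u, v - f u) \<in> epi h \<longleftrightarrow> (u, v) \<in> epi (\<lambda>u. h u + ereal (f u))" for u v
    by (cases "h u") (auto simp: epi_def)
  have "s *\<^sub>R (a, r - f a) + t *\<^sub>R (b, q - f b) \<in> epi h"
    using P Q in_epi[of a r] in_epi[of b q] by (intro convexD[OF assms(1)] st) (simp_all add: P_eq Q_eq)
  then have "h (s *\<^sub>R a + t *\<^sub>R b) \<le> ereal (s * (r - f a) + t * (q - f b))"
    by (simp add: epi_def)
  then have "h (s *\<^sub>R a + t *\<^sub>R b) + ereal (f (s *\<^sub>R a + t *\<^sub>R b))
      \<le> ereal (s * (r - f a) + t * (q - f b)) + ereal (f (s *\<^sub>R a + t *\<^sub>R b))"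
    by (rule add_right_mono)
  also have "\<dots> \<le> ereal (s * r + t * q)"
    using assms(2) st unfolding convex_on_def by (simp add: algebra_simps)
  finally show "s *\<^sub>R P + t *\<^sub>R Q \<in> epi (\<lambda>u. h u + ereal (f u))"
    by (simp add: epi_def P_eq Q_eq)
qed

lemma proper_fun_add: "proper_fun h \<Longrightarrow> proper_fun (\<lambda>u. h u + ereal (f u))"
  by (auto simp: proper_fun_def edom_def)

text \<open>
  Averaging the affine minorants given by the \<open>v i\<close> yields an affine minorant of \<open>h\<close> which, by
  Jensen, lies at most \<open>e\<close> below \<open>h m\<close> at \<open>m\<close>. Evaluating this minorant at \<open>m\<close> itself shows
  \<open>0 \<le> e\<close>.
\<close>

lemma subgradient_averages:
  fixes h :: "'a::euclidean_space \<Rightarrow> ereal" and I :: "'i set"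
  assumes proper: "proper_fun h" and conv: "convex (epi h)"
    and fin: "finite I" and a: "\<And>i. i \<in> I \<Longrightarrow> 0 \<le> a i" "sum a I = 1"
    and v: "\<And>i. i \<in> I \<Longrightarrow> v i \<in> subdiff h (u i)"
  defines "m \<equiv> \<Sum>i\<in>I. a i *\<^sub>R u i"
  defines "e \<equiv> \<Sum>i\<in>I. a i * ((u i - m) \<bullet> v i)"
  shows "0 \<le> e" and "(\<Sum>i\<in>I. a i *\<^sub>R v i) \<in> eps_subdiff e h m"
proof -
  have "\<exists>r. h (u i) = ereal r" if "i \<in> I" for i
    using eps_subdiff_finite[OF proper v[OF that]] by metis
  then obtain r where r: "\<And>i. i \<in> I \<Longrightarrow> h (u i) = ereal (r i)" by metis
  define s where "s = (\<Sum>i\<in>I. a i * r i)"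
  have "(\<Sum>i\<in>I. a i *\<^sub>R (u i, r i)) \<in> epi h"
    using r by (intro convex_sum fin conv a) (auto simp: epi_def)
  then have hm: "h m \<le> ereal s"
    by (simp add: epi_def m_def s_def sum_prod case_prod_unfold fst_sum snd_sum)
  then obtain q where q: "h m = ereal q" "q \<le> s"
    using proper by (cases "h m") (auto simp: proper_fun_def)
  have e: "e = (\<Sum>i\<in>I. a i * (u i \<bullet> v i)) - m \<bullet> (\<Sum>i\<in>I. a i *\<^sub>R v i)"
    by (simp add: e_def inner_diff_left algebra_simps sum_subtractf inner_sum_right sum_distrib_left)
  have below: "s + (\<Sum>i\<in>I. a i *\<^sub>R v i) \<bullet> (u' - m) - e \<le> b" if "h u' = ereal b" for u' b
  proof -
    have "r i + v i \<bullet> (u' - u i) \<le> b" if "i \<in> I" for i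
      using v[OF that] r[OF that] \<open>h u' = ereal b\<close>
      by (auto simp: eps_subdiff_def simp flip: zero_ereal_def dest: spec[of _ u'])
    then have "(\<Sum>i\<in>I. a i * (r i + v i \<bullet> (u' - u i))) \<le> (\<Sum>i\<in>I. a i * b)"
      by (intro sum_mono mult_left_mono a) auto
    also have "\<dots> = b" using a(2) by (simp flip: sum_distrib_right)
    also have "(\<Sum>i\<in>I. a i * (r i + v i \<bullet> (u' - u i)))
        = s + (\<Sum>i\<in>I. a i *\<^sub>R v i) \<bullet> (u' - m) - e"
      by (simp add: e s_def inner_diff_right algebra_simps sum.distrib sum_subtractf inner_sum_left
          inner_sum_right) (simp add: inner_commute)
    finally show ?thesis .
  qed
  show "0 \<le> e" using below[OF q(1)] q(2) by simp
  show "(\<Sum>i\<in>I. a i *\<^sub>R v i) \<in> eps_subdiff e h m"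
    unfolding eps_subdiff_def
  proof (intro CollectI allI)
    fix u'
    show "h m + ereal ((\<Sum>i\<in>I. a i *\<^sub>R v i) \<bullet> (u' - m)) - ereal e \<le> h u'"
      using below[of u'] q proper by (cases "h u'") (auto simp: proper_fun_def)
  qed
qed

text \<open>
  Since the second summand is quadratic along lines, the optimality condition is obtained directly:
  compare \<open>m\<close> with \<open>m + t *\<^sub>R (u - m)\<close>, use convexity of \<open>h\<close>, divide by \<open>t\<close> and let \<open>t\<close> tend to
  zero. This replaces the sum rule of the subdifferential calculus.
\<close>

lemma subgradient_of_quadratic_minimizer:
  fixes h :: "'a::euclidean_space \<Rightarrow> ereal" and q :: "'a \<Rightarrow> real"
  assumes proper: "proper_fun h" and conv: "convex (epi h)"
    and min: "\<And>u. h m + ereal (q m) \<le> h u + ereal (q u)"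
    and q: "\<And>d t. q (m + t *\<^sub>R d) = q m + t * (v \<bullet> d) + t\<^sup>2 * Q d"
  shows "- v \<in> subdiff h m"
proof -
  obtain u0 where "h u0 < \<infinity>"
    using proper by (auto simp: proper_fun_def edom_def)
  then obtain r where r: "h m = ereal r"
    using min[of u0] proper by (cases "h m"; cases "h u0") (auto simp: proper_fun_def)
  have "r - v \<bullet> (u - m) \<le> b" if b: "h u = ereal b" for u b
  proof -
    define d where "d = u - m"
    have *: "r - v \<bullet> d \<le> b + t * Q d" if t: "0 < t" "t < 1" for t
    proof -
      have "(1 - t) *\<^sub>R (m, r) + t *\<^sub>R (u, b) \<in> epi h"
        using t r b by (intro convexD[OF conv]) (auto simp: epi_def)
      moreover have "(1 - t) *\<^sub>R m + t *\<^sub>R u = m + t *\<^sub>R d"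
        by (simp add: d_def algebra_simps)
      ultimately have "h (m + t *\<^sub>R d) \<le> ereal ((1 - t) * r + t * b)"
        by (simp add: epi_def)
      then have "h (m + t *\<^sub>R d) + ereal (q (m + t *\<^sub>R d))
          \<le> ereal ((1 - t) * r + t * b) + ereal (q (m + t *\<^sub>R d))"
        by (rule add_right_mono)
      with min[of "m + t *\<^sub>R d"] have "r + q m \<le> (1 - t) * r + t * b + q (m + t *\<^sub>R d)"
        by (simp add: r) (metis (no_types, lifting) ereal_less_eq(3) order_trans plus_ereal.simps(1))
      then have "0 \<le> t * (b + t * Q d - (r - v \<bullet> d))"
        by (simp add: q power2_eq_square algebra_simps)
      with t show ?thesis by (simp add: zero_le_mult_iff)
    qed
    have "((\<lambda>t. b + t * Q d) \<longlongrightarrow> b + 0 * Q d) (at_right 0)"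
      by (intro tendsto_intros)
    moreover have "\<forall>\<^sub>F t in at_right 0. r - v \<bullet> d \<le> b + t * Q d"
      using * by (auto simp: eventually_at_right_field intro: exI[of _ 1])
    ultimately have "r - v \<bullet> d \<le> b + 0 * Q d"
      by (rule tendsto_lowerbound) simp
    then show ?thesis by (simp add: d_def)
  qed
  then show ?thesis
    using r proper unfolding eps_subdiff_def
    by (intro CollectI allI, rename_tac u, case_tac "h u") (auto simp: proper_fun_def)
qed

text \<open>
  The shape of both subproblems, with the other block held fixed and absorbed in \<open>e\<close>.
\<close>

lemma subgradient_of_proximal_minimizer:
  fixes h :: "'y::euclidean_space \<Rightarrow> ereal" and A :: "'x::euclidean_space \<Rightarrow> 'y"
  assumes "proper_fun h" "convex (epi h)" and A: "linear A" and E: "psd_op E"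
    and min: "\<And>u. h m + ereal (x \<bullet> (adjoint A m + e) + \<beta> / 2 * (norm (adjoint A m + e))\<^sup>2
        + 1/2 * (op_norm E (m - u0))\<^sup>2)
      \<le> h u + ereal (x \<bullet> (adjoint A u + e) + \<beta> / 2 * (norm (adjoint A u + e))\<^sup>2
        + 1/2 * (op_norm E (u - u0))\<^sup>2)"
  shows "E (u0 - m) - A (x + \<beta> *\<^sub>R (adjoint A m + e)) \<in> subdiff h m"
proof -
  note linA = linear_add[OF adjoint_linear[OF A]] linear_scale[OF adjoint_linear[OF A]]
  note linE = linear_add[OF psd_op_linear[OF E]] linear_scale[OF psd_op_linear[OF E]]
  define v where "v = A (x + \<beta> *\<^sub>R (adjoint A m + e)) + E (m - u0)"
  define Q where "Q d = \<beta> / 2 * (norm (adjoint A d))\<^sup>2 + 1/2 * (d \<bullet> E d)" for d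
  have "- v \<in> subdiff h m"
  proof (rule subgradient_of_quadratic_minimizer[OF assms(1,2) min])
    fix d and t :: real
    define \<rho> a s where "\<rho> = adjoint A m + e" and "a = adjoint A d" and "s = m - u0"
    have \<rho>: "adjoint A (m + t *\<^sub>R d) + e = \<rho> + t *\<^sub>R a"
      by (simp add: \<rho>_def a_def linA)
    have s: "m + t *\<^sub>R d - u0 = s + t *\<^sub>R d" by (simp add: s_def)
    have v: "v \<bullet> d = x \<bullet> a + \<beta> * (\<rho> \<bullet> a) + d \<bullet> E s"
      using adjoint_works[OF A, of "x + \<beta> *\<^sub>R \<rho>" d]
      by (simp add: v_def \<rho>_def[symmetric] a_def s_def inner_add_left inner_add_right inner_commute)
    have Es: "(s + t *\<^sub>R d) \<bullet> E (s + t *\<^sub>R d) = s \<bullet> E s + 2 * t * (d \<bullet> E s) + t\<^sup>2 * (d \<bullet> E d)"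
      using psd_op_sym[OF E, of s d]
      by (simp add: linE inner_add_left inner_add_right power2_eq_square algebra_simps)
    have n: "(norm (\<rho> + t *\<^sub>R a))\<^sup>2 = (norm \<rho>)\<^sup>2 + 2 * t * (\<rho> \<bullet> a) + t\<^sup>2 * (norm a)\<^sup>2"
      unfolding power2_norm_eq_inner
      by (simp add: inner_add_left inner_add_right inner_commute power2_eq_square algebra_simps)
    show "x \<bullet> (adjoint A (m + t *\<^sub>R d) + e) + \<beta> / 2 * (norm (adjoint A (m + t *\<^sub>R d) + e))\<^sup>2
          + 1/2 * (op_norm E (m + t *\<^sub>R d - u0))\<^sup>2
        = x \<bullet> (adjoint A m + e) + \<beta> / 2 * (norm (adjoint A m + e))\<^sup>2 + 1/2 * (op_norm E (m - u0))\<^sup>2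
          + t * (v \<bullet> d) + t\<^sup>2 * Q d"
      unfolding \<rho> s op_norm_sq[OF E] Es n v Q_def \<rho>_def[symmetric] s_def[symmetric] a_def[symmetric]
      by (simp add: inner_add_right algebra_simps)
  qed
  moreover have "- v = E (u0 - m) - A (x + \<beta> *\<^sub>R (adjoint A m + e))"
    by (simp add: v_def linear_diff[OF psd_op_linear[OF E]])
  ultimately show ?thesis by simp
qed

lemma strong_mono_withD:
  assumes "proper_fun h" "psd_op E" "strong_mono_with h E" "u \<in> subdiff h a" "v \<in> subdiff h b"
  shows "(a - b) \<bullet> E (a - b) \<le> (u - v) \<bullet> (a - b)"
proof -
  obtain r s where "h a = ereal r" "h b = ereal s"
    using eps_subdiff_finite[OF assms(1)] assms(4,5) by metis
  then show ?thesis
    using assms unfolding strong_mono_with_def by (simp add: edom_def op_norm_sq[OF assms(2)])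
qed

lemma edist_0_sq_le:
  fixes a :: "'a::real_normed_vector"
  assumes "a \<in> X"
  shows "(edist 0 X)\<^sup>2 \<le> ereal ((norm a)\<^sup>2)"
proof -
  have "0 \<le> edist 0 X" by (auto simp: edist_def intro: INF_greatest)
  moreover have "edist 0 X \<le> ereal (norm a)"
    using assms INF_lower[of a X "\<lambda>s. ereal (dist 0 s)"] by (simp add: edist_def)
  ultimately show ?thesis by (cases "edist 0 X") (auto simp: power_mono)
qed

section \<open>The constants of the relative error inequality\<close>

text \<open>
  The golden ratio bound is equivalent to \<open>0 < 1 + \<tau> - \<tau>\<^sup>2\<close> for positive \<open>\<tau>\<close>. This sign makes the
  second argument of the maximum smaller than one and, for \<open>\<tau> > 1\<close>, decides the last claim, which
  is the discriminant condition for the quadratic form met in the relative error inequality.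
\<close>

lemma step_size_constants:
  fixes \<tau> :: real
  assumes "0 < \<tau>" "\<tau> < (1 + sqrt 5) / 2"
  defines "\<sigma> \<equiv> sigma_const \<tau>"
  shows sigma_const_less_1: "\<sigma> < 1"
    and sigma_const_ge_square: "(\<tau> - 1)\<^sup>2 \<le> \<sigma>"
    and sigma_const_plus_pos: "0 < \<sigma> + \<tau> - 1"
    and sigma_const_times_ge: "1 \<le> \<sigma> * (\<tau> + 1)"
    and sigma_const_discriminant:
      "((\<sigma> + \<tau> - 1) * (1 - \<tau>))\<^sup>2 \<le> (\<sigma> * (\<tau> + 1) - 1) * (\<sigma> - (\<tau> - 1)\<^sup>2)"
proof -
  define a where "a = (\<tau> - 1)\<^sup>2"
  have "0 < ((1 + sqrt 5) / 2 - \<tau>) * (\<tau> + (sqrt 5 - 1) / 2)"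
    using assms real_less_rsqrt[of 1 5] by (intro mult_pos_pos add_pos_pos) simp_all
  then have golden: "0 < 1 + \<tau> - \<tau>\<^sup>2"
    by (simp add: power2_eq_square field_simps)
  have "sqrt 5 < 3" by (rule real_less_lsqrt) auto
  then have "\<tau> < 2" using assms(2) by (simp add: field_simps)
  have "a = 1 - \<tau> * (2 - \<tau>)" by (simp add: a_def power2_eq_square algebra_simps)
  moreover have "0 < \<tau> * (2 - \<tau>)" using assms(1) \<open>\<tau> < 2\<close> by simp
  moreover have "0 \<le> a" by (simp add: a_def)
  ultimately have a: "0 \<le> a" "a < 1" by auto
  have a_eq: "a = \<tau>\<^sup>2 - 2 * \<tau> + 1" by (simp add: a_def power2_eq_square algebra_simps)
  have \<sigma>_eq: "\<sigma> = max ((2 - \<tau>) / 2) ((1 + \<tau> * a) / (2 - a))"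
    by (simp add: \<sigma>_def sigma_const_def a_def power2_commute)
  then have ge1: "(2 - \<tau>) / 2 \<le> \<sigma>" and ge2: "(1 + \<tau> * a) / (2 - a) \<le> \<sigma>" by auto
  have ge2': "1 + \<tau> * a \<le> \<sigma> * (2 - a)" using ge2 a by (simp add: divide_le_eq)
  have "0 < \<tau> * (1 + \<tau> - \<tau>\<^sup>2)" using golden assms(1) by simp
  then have "1 + \<tau> * a < 2 - a" by (simp add: a_eq power2_eq_square algebra_simps)
  then show "\<sigma> < 1" using a assms(1) by (simp add: \<sigma>_eq)
  have "a * (2 - a) \<le> 1 + \<tau> * a"
    using zero_le_power2[of "1 - a"] mult_nonneg_nonneg[OF less_imp_le[OF assms(1)] a(1)]
    by (simp add: power2_eq_square algebra_simps)
  with ge2' have "a * (2 - a) \<le> \<sigma> * (2 - a)" by linarith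
  then show "(\<tau> - 1)\<^sup>2 \<le> \<sigma>" using a by (simp add: a_def)
  show "0 < \<sigma> + \<tau> - 1" using ge1 assms(1) by (simp add: field_simps)
  show times: "1 \<le> \<sigma> * (\<tau> + 1)"
  proof (cases "\<tau> \<le> 1")
    case True
    have "1 \<le> (2 - \<tau>) / 2 * (\<tau> + 1)"
      using mult_nonneg_nonneg[of \<tau> "1 - \<tau>"] True assms(1) by (simp add: field_simps)
    also have "\<dots> \<le> \<sigma> * (\<tau> + 1)" using ge1 assms(1) by (intro mult_right_mono) auto
    finally show ?thesis .
  next
    case False
    have "0 \<le> \<tau> * (\<tau> - 1) + \<tau> * (\<tau> + 1) * a"
      using a False assms(1) by (intro add_nonneg_nonneg mult_nonneg_nonneg) auto
    then have "2 - a \<le> (1 + \<tau> * a) * (\<tau> + 1)"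
      by (simp add: a_eq power2_eq_square algebra_simps)
    also have "\<dots> \<le> \<sigma> * (2 - a) * (\<tau> + 1)"
      using ge2' assms(1) by (intro mult_right_mono) auto
    finally have "1 * (2 - a) \<le> (\<sigma> * (\<tau> + 1)) * (2 - a)" by (simp add: mult_ac)
    then show ?thesis using a by (subst (asm) mult_le_cancel_right) simp
  qed
  \<comment> \<open>The difference of the two sides is \<open>\<tau>\<close> times a convex quadratic \<open>q\<close> in \<open>\<sigma>\<close>; it suffices
    that \<open>q\<close> and its derivative are nonnegative at whichever of the two lower bounds for
    \<open>\<sigma>\<close> is relevant, the first one for \<open>\<tau> \<le> 1\<close> and the second one for \<open>\<tau> > 1\<close>.\<close>
  define q where "q s = (3 - \<tau>) * s\<^sup>2 - (2 - \<tau> + 3 * a) * s + a * (2 - \<tau>)" for s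
  have q_mono: "0 \<le> q \<sigma>" if "s \<le> \<sigma>" "0 \<le> q s" "0 \<le> 2 * (3 - \<tau>) * s - (2 - \<tau> + 3 * a)" for s
  proof -
    have "q \<sigma> = q s + (2 * (3 - \<tau>) * s - (2 - \<tau> + 3 * a)) * (\<sigma> - s) + (3 - \<tau>) * (\<sigma> - s)\<^sup>2"
      by (simp add: q_def power2_eq_square algebra_simps)
    then show ?thesis using that \<open>\<tau> < 2\<close> by simp
  qed
  have "0 \<le> q \<sigma>"
  proof (cases "\<tau> \<le> 1")
    case True
    have "q ((2 - \<tau>) / 2) = (2 - \<tau>) * \<tau> * (1 - \<tau>) / 4"
      by (simp add: q_def a_eq power2_eq_square field_simps)
    also have "\<dots> \<ge> 0" using True assms(1) by simp
    finally have 1: "0 \<le> q ((2 - \<tau>) / 2)" .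
    have "2 * (3 - \<tau>) * ((2 - \<tau>) / 2) - (2 - \<tau> + 3 * a) = 1 + 2 * (\<tau> * (1 - \<tau>))"
      by (simp add: a_eq power2_eq_square field_simps)
    also have "\<dots> \<ge> 0" using True assms(1) by simp
    finally show ?thesis by (rule q_mono[OF ge1 1])
  next
    case False
    define s where "s = \<tau> - 1"
    have \<tau>: "\<tau> = 1 + s" and as: "a = s\<^sup>2" by (auto simp: s_def a_def)
    have s: "0 < s" "s < 1" "0 < 1 - s - s\<^sup>2"
      using False \<open>\<tau> < 2\<close> golden by (auto simp: s_def power2_eq_square algebra_simps)
    define u where "u = (1 + \<tau> * a) / (2 - a)"
    have "u * (2 - a) = 1 + \<tau> * a" using a by (simp add: u_def)
    then have u: "u * (2 - s\<^sup>2) = 1 + s\<^sup>2 + s ^ 3"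
      by (simp add: as \<tau> power2_eq_square power3_eq_cube algebra_simps)
    have "q u * (2 - a)\<^sup>2 = (3 - \<tau>) * (u * (2 - a))\<^sup>2 - (2 - \<tau> + 3 * a) * (u * (2 - a)) * (2 - a)
        + a * (2 - \<tau>) * (2 - a)\<^sup>2"
      by (simp add: q_def power2_eq_square algebra_simps)
    also have "\<dots> = s * (1 - s) * (1 + s) ^ 3 * (1 - s - s\<^sup>2)"
      unfolding as u unfolding \<tau> by (simp add: algebra_simps power2_eq_square power3_eq_cube)
    also have "\<dots> \<ge> 0" using s by (intro mult_nonneg_nonneg) auto
    finally have 1: "0 \<le> q u" using a by (simp add: zero_le_mult_iff)
    have "(2 * (3 - \<tau>) * u - (2 - \<tau> + 3 * a)) * (2 - a)
        = 2 * (3 - \<tau>) * (u * (2 - a)) - (2 - \<tau> + 3 * a) * (2 - a)"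
      by (simp add: algebra_simps)
    also have "\<dots> = 2 - s\<^sup>2 + s ^ 3 + s ^ 4"
      unfolding as u unfolding \<tau> by (simp add: algebra_simps power2_eq_square power3_eq_cube power4_eq_xxxx)
    also have "\<dots> \<ge> 0" using a s by (simp add: as add_nonneg_nonneg)
    finally have 2: "0 \<le> 2 * (3 - \<tau>) * u - (2 - \<tau> + 3 * a)" using a by (simp add: zero_le_mult_iff)
    show ?thesis using ge2 1 2 by (intro q_mono[of u]) (simp_all add: u_def)
  qed
  then have "0 \<le> \<tau> * q \<sigma>" using assms(1) by simp
  also have "\<tau> * q \<sigma> = (\<sigma> * (\<tau> + 1) - 1) * (\<sigma> - (\<tau> - 1)\<^sup>2) - ((\<sigma> + \<tau> - 1) * (1 - \<tau>))\<^sup>2"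
    by (simp add: q_def a_eq power2_eq_square algebra_simps)
  finally show "((\<sigma> + \<tau> - 1) * (1 - \<tau>))\<^sup>2 \<le> (\<sigma> * (\<tau> + 1) - 1) * (\<sigma> - (\<tau> - 1)\<^sup>2)"
    by simp
qed

lemma quadratic_form_nonneg:
  fixes b r :: "'a::real_inner"
  assumes "0 \<le> m" "0 \<le> n" "l\<^sup>2 \<le> m * n"
  shows "2 * l * (r \<bullet> b) \<le> m * (b \<bullet> b) + n * (r \<bullet> r)"
proof (rule power2_le_imp_le)
  have "(2 * l * (r \<bullet> b))\<^sup>2 = 4 * l\<^sup>2 * (r \<bullet> b)\<^sup>2"
    by (simp add: power_mult_distrib)
  also have "\<dots> \<le> 4 * (m * n) * ((r \<bullet> r) * (b \<bullet> b))"
    using assms Cauchy_Schwarz_ineq[of r b] by (intro mult_mono) auto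
  also have "\<dots> \<le> (m * (b \<bullet> b) + n * (r \<bullet> r))\<^sup>2"
    using sum_squares_bound[of "m * (b \<bullet> b)" "n * (r \<bullet> r)"]
    by (simp add: power2_eq_square algebra_simps)
  finally show "(2 * l * (r \<bullet> b))\<^sup>2 \<le> (m * (b \<bullet> b) + n * (r \<bullet> r))\<^sup>2" .
qed (use assms in auto)

text \<open>
  The boundary term at \<open>i = 1\<close> vanishes because \<open>\<alpha> 1 = 0\<close>.
\<close>

lemma sum_by_parts:
  fixes u :: "nat \<Rightarrow> 'a::real_vector"
  assumes "\<alpha> 1 = 0"
  shows "(\<Sum>i=1..k. \<alpha> (Suc i) *\<^sub>R (u i - u (Suc i)))
    = (\<Sum>i=1..k. (\<alpha> (Suc i) - \<alpha> i) *\<^sub>R u i) - \<alpha> (Suc k) *\<^sub>R u (Suc k)"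
  by (induction k) (use assms in \<open>simp_all add: algebra_simps\<close>)

section \<open>Runs of the method and their optimality conditions\<close>

text \<open>
  Here \<open>h\<close> and \<open>p\<close> are the composite objective parts, and \<open>H\<close> and \<open>P\<close> their monotonicity moduli.
  The start of the \<open>z\<close>-block has to be finite: with \<open>p (z 0) = \<infinity>\<close> the first subproblem would be
  infinite everywhere and every point a minimizer.
\<close>

locale spadmm =
  fixes h :: "'y::euclidean_space \<Rightarrow> ereal" and p :: "'z::euclidean_space \<Rightarrow> ereal"
    and A :: "'x::euclidean_space \<Rightarrow> 'y" and B :: "'x \<Rightarrow> 'z" and c :: 'x
    and \<beta> \<tau> :: real and S H :: "'y \<Rightarrow> 'y" and T P :: "'z \<Rightarrow> 'z"
    and y :: "nat \<Rightarrow> 'y" and z :: "nat \<Rightarrow> 'z" and x :: "nat \<Rightarrow> 'x"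
  assumes h: "proper_fun h" "convex (epi h)" and p: "proper_fun p" "convex (epi p)"
    and A: "linear A" and B: "linear B"
    and \<beta>: "0 < \<beta>" and \<tau>: "0 < \<tau>" "\<tau> < (1 + sqrt 5) / 2"
    and S: "psd_op S" and T: "psd_op T"
    and H: "psd_op H" "strong_mono_with h H" and P: "psd_op P" "strong_mono_with p P"
    and z0: "z 0 \<in> edom p"
    and step: "spadmm_step h p A B c \<beta> \<tau> S T (y i, z i, x i) (y (Suc i), z (Suc i), x (Suc i))"
begin

text \<open>
  The multiplier extrapolated with the old \<open>z\<close>: with it, the two subproblems and the multiplier update
  become one inclusion in the KKT operator.
\<close>

definition xt :: "nat \<Rightarrow> 'x" where
  "xt i = x (i - 1) + \<beta> *\<^sub>R resid A B c (y i) (z (i - 1))"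

definition r :: "nat \<Rightarrow> 'x" where "r i = resid A B c (y i) (z i)"
definition w :: "nat \<Rightarrow> 'y \<times> 'z \<times> 'x" where "w i = (y i, z i, x i)"
definition wt :: "nat \<Rightarrow> 'y \<times> 'z \<times> 'x" where "wt i = (y i, z i, xt i)"

abbreviation \<sigma> :: real where "\<sigma> \<equiv> sigma_const \<tau>"

definition T' :: "'z \<Rightarrow> 'z" where "T' = (\<lambda>v. T v + \<beta> *\<^sub>R B (adjoint B v))"

definition G :: "'y \<times> 'z \<times> 'x \<Rightarrow> 'y \<times> 'z \<times> 'x" where
  "G = diag_op S T' (\<lambda>u. inverse (\<tau> * \<beta>) *\<^sub>R u)"

definition \<Sigma> :: "'y \<times> 'z \<times> 'x \<Rightarrow> 'y \<times> 'z \<times> 'x" where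
  "\<Sigma> = diag_op H P (\<lambda>u. 0)"

definition M :: "'y \<times> 'z \<times> 'x \<Rightarrow> 'y \<times> 'z \<times> 'x" where "M = (\<lambda>u. G u + \<Sigma> u)"

text \<open>
  Potential of the relative error inequality: the slack gained in one step, from which the cross
  terms of the next step are paid.
\<close>

definition \<eta>t :: "nat \<Rightarrow> real" where
  "\<eta>t i = (\<sigma> - (\<tau> - 1)\<^sup>2) * \<beta> / (2 * \<tau>) * (norm (r i))\<^sup>2
     + \<sigma> / 2 * (op_norm S (y i - y (i - 1)))\<^sup>2
     + nu_const \<tau> / (2 * \<tau>) * (op_norm T (z i - z (i - 1)))\<^sup>2
     + (\<sigma> + \<tau> - 1) / \<tau> * (op_norm P (z i - z (i - 1)))\<^sup>2"

definition \<eta> :: "nat \<Rightarrow> real" where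
  "\<eta> i = \<eta>t i + 1/4 * (op_norm \<Sigma> (w i - w (i - 1)))\<^sup>2"

lemma linear_adjoints: "linear (adjoint A)" "linear (adjoint B)"
  using A B by (auto intro: adjoint_linear)

lemma psd_T': "psd_op T'"
  unfolding T'_def by (intro psd_op_add T psd_op_gram B) (use \<beta> in simp)

lemma psd_G: "psd_op G"
  unfolding G_def by (intro psd_op_diag S psd_T' psd_op_scale) (use \<beta> \<tau> in simp)

lemma psd_zero: "psd_op (\<lambda>u. 0)"
  by (intro psd_opI linear_zero) auto

lemma psd_\<Sigma>: "psd_op \<Sigma>"
  unfolding \<Sigma>_def by (intro psd_op_diag H P psd_zero)

lemma psd_M: "psd_op M"
  unfolding M_def by (intro psd_op_add psd_G psd_\<Sigma>)

lemma op_dist_M: "op_dist M u v = op_dist G u v + op_dist \<Sigma> u v"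
  by (simp add: op_dist_inner psd_M psd_G psd_\<Sigma>) (simp add: M_def inner_add_right add_divide_distrib)

lemma x_Suc: "x (Suc i) = x i + (\<tau> * \<beta>) *\<^sub>R r (Suc i)"
  using step[of i] by (simp add: spadmm_step_def r_def)

lemma resid_old_z: "resid A B c (y (Suc i)) (z i) = r (Suc i) - adjoint B (z (Suc i) - z i)"
  by (simp add: resid_def r_def linear_diff[OF linear_adjoints(2)])

lemma xt_Suc: "xt (Suc i) = x i + \<beta> *\<^sub>R (r (Suc i) - adjoint B (z (Suc i) - z i))"
  by (simp add: xt_def resid_old_z)

text \<open>
  The value of \<open>p\<close> at the old \<open>z\<close> has to be finite for the first subproblem to determine anything;
  the second conclusion shows that the new value is finite again, so the argument can be iterated.
\<close>

lemma step_optimality: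
  assumes "p (z i) = ereal s"
  shows "S (y i - y (Suc i)) - A (xt (Suc i)) \<in> subdiff h (y (Suc i))"
    and "T (z i - z (Suc i)) - B (x i + \<beta> *\<^sub>R r (Suc i)) \<in> subdiff p (z (Suc i))"
proof -
  have "S (y i - y (Suc i)) - A (x i + \<beta> *\<^sub>R (adjoint A (y (Suc i)) + (adjoint B (z i) - c)))
      \<in> subdiff h (y (Suc i))"
  proof (rule subgradient_of_proximal_minimizer[OF h A S])
    fix u
    let ?L = "\<lambda>u. aug_lagrangian h p A B c \<beta> u (z i) (x i) + ereal (1/2 * (op_norm S (u - y i))\<^sup>2)"
    let ?q = "\<lambda>u. x i \<bullet> (adjoint A u + (adjoint B (z i) - c))
      + \<beta> / 2 * (norm (adjoint A u + (adjoint B (z i) - c)))\<^sup>2 + 1/2 * (op_norm S (u - y i))\<^sup>2"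
    have L: "?L v = h v + ereal (?q v) + ereal s" for v
      using assms by (cases "h v") (simp_all add: aug_lagrangian_def resid_def algebra_simps)
    have "?L (y (Suc i)) \<le> ?L u"
      using step[of i] by (auto simp: spadmm_step_def is_arg_min_def not_less)
    then show "h (y (Suc i)) + ereal (?q (y (Suc i))) \<le> h u + ereal (?q u)"
      unfolding L by (subst (asm) ereal_add_le_add_iff2) auto
  qed
  then show hy: "S (y i - y (Suc i)) - A (xt (Suc i)) \<in> subdiff h (y (Suc i))"
    by (simp add: xt_def resid_def algebra_simps)
  obtain t where t: "h (y (Suc i)) = ereal t"
    using eps_subdiff_finite[OF h(1) hy] .
  have "T (z i - z (Suc i)) - B (x i + \<beta> *\<^sub>R (adjoint B (z (Suc i)) + (adjoint A (y (Suc i)) - c)))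
      \<in> subdiff p (z (Suc i))"
  proof (rule subgradient_of_proximal_minimizer[OF p B T])
    fix u
    let ?L = "\<lambda>u. aug_lagrangian h p A B c \<beta> (y (Suc i)) u (x i) + ereal (1/2 * (op_norm T (u - z i))\<^sup>2)"
    let ?q = "\<lambda>u. x i \<bullet> (adjoint B u + (adjoint A (y (Suc i)) - c))
      + \<beta> / 2 * (norm (adjoint B u + (adjoint A (y (Suc i)) - c)))\<^sup>2 + 1/2 * (op_norm T (u - z i))\<^sup>2"
    have L: "?L v = p v + ereal (?q v) + ereal t" for v
      using t by (cases "p v") (simp_all add: aug_lagrangian_def resid_def algebra_simps)
    have "?L (z (Suc i)) \<le> ?L u"
      using step[of i] by (auto simp: spadmm_step_def is_arg_min_def not_less)
    then show "p (z (Suc i)) + ereal (?q (z (Suc i))) \<le> p u + ereal (?q u)"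
      unfolding L by (subst (asm) ereal_add_le_add_iff2) auto
  qed
  then show "T (z i - z (Suc i)) - B (x i + \<beta> *\<^sub>R r (Suc i)) \<in> subdiff p (z (Suc i))"
    by (simp add: r_def resid_def algebra_simps)
qed

lemma p_finite: "\<exists>s. p (z i) = ereal s"
proof (induction i)
  case 0
  then show ?case using z0 p(1) by (cases "p (z 0)") (auto simp: edom_def proper_fun_def)
next
  case (Suc i)
  then obtain s where "p (z i) = ereal s" ..
  from eps_subdiff_finite[OF p(1) step_optimality(2)[OF this]] show ?case by blast
qed

lemma y_subgradient: "S (y i - y (Suc i)) - A (xt (Suc i)) \<in> subdiff h (y (Suc i))"
  using p_finite[of i] step_optimality(1) by blast

lemma z_optimality: "T (z i - z (Suc i)) - B (x i + \<beta> *\<^sub>R r (Suc i)) \<in> subdiff p (z (Suc i))"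
  using p_finite[of i] step_optimality(2) by blast

text \<open>
  Passing to the extrapolated multiplier costs \<open>\<beta> *\<^sub>R B (adjoint B (z i - z (Suc i)))\<close>, which turns
  \<open>T\<close> into \<open>T'\<close>.
\<close>

lemma z_subgradient: "T' (z i - z (Suc i)) - B (xt (Suc i)) \<in> subdiff p (z (Suc i))"
proof -
  have "T' (z i - z (Suc i)) - B (xt (Suc i)) = T (z i - z (Suc i)) - B (x i + \<beta> *\<^sub>R r (Suc i))"
    by (simp add: T'_def xt_Suc linear_add[OF B] linear_diff[OF B] linear_scale[OF B]
        linear_diff[OF linear_adjoints(2)] algebra_simps)
  then show ?thesis using z_optimality by simp
qed

section \<open>The relative error inequality and Fejer monotonicity\<close>

lemma nu_const_ge: "\<sigma> + \<tau> - 1 \<le> nu_const \<tau>"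
proof -
  have "0 \<le> \<sigma> * \<tau>"
    using sigma_const_ge_square[OF \<tau>] \<tau>(1) by (intro mult_nonneg_nonneg) (auto intro: order_trans[OF zero_le_power2])
  then show ?thesis by (simp add: nu_const_def algebra_simps)
qed

lemma \<eta>t_nonneg: "0 \<le> \<eta>t i"
proof -
  have "0 \<le> \<sigma>" using sigma_const_ge_square[OF \<tau>] by (rule order_trans[OF zero_le_power2])
  then show ?thesis
    unfolding \<eta>t_def
    using sigma_const_ge_square[OF \<tau>] sigma_const_plus_pos[OF \<tau>] nu_const_ge \<tau>(1) \<beta>
    by (intro add_nonneg_nonneg mult_nonneg_nonneg divide_nonneg_nonneg) auto
qed

lemma \<eta>t_le_\<eta>: "\<eta>t i \<le> \<eta> i"
  by (simp add: \<eta>_def)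

text \<open>
  Monotonicity of the subdifferential of \<open>p\<close>, applied to two consecutive \<open>z\<close>-subproblems. It trades
  the current residual against the previous one in the cross term with the \<open>z\<close>-step, which is what
  allows step sizes above one.
\<close>

lemma z_contraction:
  fixes j
  defines "u \<equiv> z (Suc (Suc j)) - z (Suc j)" and "u' \<equiv> z (Suc j) - z j"
  shows "2 * (u \<bullet> P u) + u \<bullet> T u - u' \<bullet> T u' + 2 * \<beta> * (r (Suc (Suc j)) \<bullet> adjoint B u)
    \<le> 2 * \<beta> * (1 - \<tau>) * (r (Suc j) \<bullet> adjoint B u)"
proof -
  define b where "b = adjoint B u"
  note linT = psd_op_linear[OF T]
  have neg: "z (Suc j) - z (Suc (Suc j)) = - u" "z j - z (Suc j) = - u'"
    by (simp_all add: u_def u'_def)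
  have "u \<bullet> P u \<le> ((T (- u) - B (x (Suc j) + \<beta> *\<^sub>R r (Suc (Suc j))))
      - (T (- u') - B (x j + \<beta> *\<^sub>R r (Suc j)))) \<bullet> u"
    using strong_mono_withD[OF p(1) P z_optimality[of "Suc j"] z_optimality[of j]]
    by (simp only: neg u_def[symmetric])
  also have "\<dots> = u \<bullet> T u' - u \<bullet> T u
      - (x (Suc j) + \<beta> *\<^sub>R r (Suc (Suc j)) - (x j + \<beta> *\<^sub>R r (Suc j))) \<bullet> b"
    using adjoint_works[OF B, of "x (Suc j) + \<beta> *\<^sub>R r (Suc (Suc j)) - (x j + \<beta> *\<^sub>R r (Suc j))" u]
    by (simp add: b_def linear_neg[OF linT] linear_diff[OF B] inner_diff_left inner_diff_right inner_commute)
  also have "\<dots> = u \<bullet> T u' - u \<bullet> T u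
      - \<beta> * (r (Suc (Suc j)) \<bullet> b) + \<beta> * (1 - \<tau>) * (r (Suc j) \<bullet> b)"
    by (simp add: x_Suc[of j] inner_diff_left inner_add_left algebra_simps)
  finally have 1: "u \<bullet> P u \<le> u \<bullet> T u' - u \<bullet> T u
      - \<beta> * (r (Suc (Suc j)) \<bullet> b) + \<beta> * (1 - \<tau>) * (r (Suc j) \<bullet> b)" .
  have "0 \<le> (u - u') \<bullet> T (u - u')" by (rule psd_op_nonneg[OF T])
  then have "2 * (u \<bullet> T u') \<le> u \<bullet> T u + u' \<bullet> T u'"
    using psd_op_sym[OF T, of u u'] by (simp add: linear_diff[OF linT] inner_diff_left inner_diff_right)
  with 1 show ?thesis by (simp add: b_def)
qed

text \<open>
  The points \<open>wt (Suc i)\<close> and \<open>w (Suc i)\<close> share their first two blocks, so only the multipliers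
  contribute to the second distance.
\<close>

lemma op_dist_wt:
  fixes i
  defines "s \<equiv> y (Suc i) - y i" and "u \<equiv> z (Suc i) - z i"
  defines "b \<equiv> adjoint B u" and "\<rho> \<equiv> r (Suc i)"
  shows "2 * \<tau> * op_dist G (wt (Suc i)) (w i)
      = \<tau> * (s \<bullet> S s + u \<bullet> T u + \<beta> * (b \<bullet> b)) + \<beta> * (\<rho> \<bullet> \<rho> - 2 * (\<rho> \<bullet> b) + b \<bullet> b)"
    and "2 * \<tau> * op_dist G (wt (Suc i)) (w (Suc i))
      = \<beta> * ((1 - \<tau>)\<^sup>2 * (\<rho> \<bullet> \<rho>) - 2 * (1 - \<tau>) * (\<rho> \<bullet> b) + b \<bullet> b)"
proof -
  have 1: "wt (Suc i) - w i = (s, u, \<beta> *\<^sub>R (\<rho> - b))"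
    and 2: "wt (Suc i) - w (Suc i) = (0, 0, \<beta> *\<^sub>R ((1 - \<tau>) *\<^sub>R \<rho> - b))"
    by (simp_all add: wt_def w_def s_def u_def b_def \<rho>_def xt_Suc x_Suc algebra_simps)
  have T': "u \<bullet> T' u = u \<bullet> T u + \<beta> * (b \<bullet> b)"
    using adjoint_works[OF B, of b u] by (simp add: T'_def b_def inner_add_right inner_commute)
  have split: "2 * \<tau> * ((s, u, q) \<bullet> G (s, u, q) / 2)
      = \<tau> * (s \<bullet> S s + u \<bullet> T' u) + \<tau> * (q \<bullet> (inverse (\<tau> * \<beta>) *\<^sub>R q))" for s u q
    by (simp add: G_def diag_op_def algebra_simps)
  have scaled: "\<tau> * ((\<beta> *\<^sub>R e) \<bullet> (inverse (\<tau> * \<beta>) *\<^sub>R \<beta> *\<^sub>R e)) = \<beta> * (e \<bullet> e)" for e :: 'x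
    using \<tau>(1) \<beta> by simp
  show "2 * \<tau> * op_dist G (wt (Suc i)) (w i)
      = \<tau> * (s \<bullet> S s + u \<bullet> T u + \<beta> * (b \<bullet> b)) + \<beta> * (\<rho> \<bullet> \<rho> - 2 * (\<rho> \<bullet> b) + b \<bullet> b)"
    unfolding op_dist_inner[OF psd_G] 1 split scaled T'
    by (simp add: inner_diff_left inner_diff_right inner_commute algebra_simps)
  show "2 * \<tau> * op_dist G (wt (Suc i)) (w (Suc i))
      = \<beta> * ((1 - \<tau>)\<^sup>2 * (\<rho> \<bullet> \<rho>) - 2 * (1 - \<tau>) * (\<rho> \<bullet> b) + b \<bullet> b)"
    unfolding op_dist_inner[OF psd_G] 2 split scaled
    by (simp add: power2_eq_square inner_diff_left inner_diff_right inner_commute algebra_simps)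
qed

lemma \<eta>t_Suc:
  fixes i
  defines "s \<equiv> y (Suc i) - y i" and "u \<equiv> z (Suc i) - z i"
  shows "2 * \<tau> * \<eta>t (Suc i) = (\<sigma> - (\<tau> - 1)\<^sup>2) * \<beta> * (r (Suc i) \<bullet> r (Suc i)) + \<tau> * \<sigma> * (s \<bullet> S s)
    + nu_const \<tau> * (u \<bullet> T u) + 2 * (\<sigma> + \<tau> - 1) * (u \<bullet> P u)"
  using \<tau>(1) by (simp add: \<eta>t_def s_def u_def op_norm_sq S T P(1) power2_norm_eq_inner field_simps)

text \<open>
  After multiplication by \<open>2 * \<tau>\<close> and substitution of the distances and potentials, the squares of
  the \<open>y\<close>-step and of the current residual cancel. The cross term of the current residual with the
  \<open>z\<close>-step is removed by \<open>z_contraction\<close> with weight \<open>\<kappa>\<close>, and what remains is covered by the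
  previous potential and a nonnegative quadratic form in the \<open>z\<close>-step and the previous residual.
\<close>

lemma relative_error:
  "op_dist G (wt (Suc (Suc j))) (w (Suc (Suc j))) + \<eta>t (Suc (Suc j))
    \<le> \<sigma> * op_dist G (wt (Suc (Suc j))) (w (Suc j)) + \<eta>t (Suc j)"
proof -
  define s where "s = y (Suc (Suc j)) - y (Suc j)"
  define s' where "s' = y (Suc j) - y j"
  define u where "u = z (Suc (Suc j)) - z (Suc j)"
  define u' where "u' = z (Suc j) - z j"
  define b where "b = adjoint B u"
  define \<rho> where "\<rho> = r (Suc (Suc j))"
  define \<rho>' where "\<rho>' = r (Suc j)"
  define \<kappa> where "\<kappa> = \<sigma> + \<tau> - 1"
  have \<kappa>: "0 < \<kappa>" using sigma_const_plus_pos[OF \<tau>] by (simp add: \<kappa>_def)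
  have \<sigma>: "0 \<le> \<sigma>" using sigma_const_ge_square[OF \<tau>] by (rule order_trans[OF zero_le_power2])
  note D = op_dist_wt[of "Suc j", folded s_def u_def, folded b_def \<rho>_def]
  note \<eta>2 = \<eta>t_Suc[of "Suc j", folded s_def u_def \<rho>_def]
  have \<eta>1: "(\<sigma> - (\<tau> - 1)\<^sup>2) * \<beta> * (\<rho>' \<bullet> \<rho>') + \<kappa> * (u' \<bullet> T u') \<le> 2 * \<tau> * \<eta>t (Suc j)"
  proof -
    have "\<kappa> * (u' \<bullet> T u') \<le> nu_const \<tau> * (u' \<bullet> T u')"
      unfolding \<kappa>_def by (intro mult_right_mono nu_const_ge psd_op_nonneg T)
    moreover have "0 \<le> \<tau> * \<sigma> * (s' \<bullet> S s')"
      using \<tau>(1) \<sigma> psd_op_nonneg[OF S] by (intro mult_nonneg_nonneg) auto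
    moreover have "0 \<le> 2 * \<kappa> * (u' \<bullet> P u')"
      using \<kappa> psd_op_nonneg[OF P(1)] by (intro mult_nonneg_nonneg) auto
    ultimately show ?thesis
      unfolding \<eta>t_Suc[of j, folded s'_def u'_def \<rho>'_def] \<kappa>_def by linarith
  qed
  have z: "\<kappa> * (2 * (u \<bullet> P u) + u \<bullet> T u - u' \<bullet> T u' + 2 * \<beta> * (\<rho> \<bullet> b))
      \<le> \<kappa> * (2 * \<beta> * (1 - \<tau>) * (\<rho>' \<bullet> b))"
    using z_contraction[of j] \<kappa>
    by (intro mult_left_mono) (simp_all add: u_def u'_def b_def \<rho>_def \<rho>'_def)
  have "2 * (\<kappa> * (1 - \<tau>)) * (\<rho>' \<bullet> b)
      \<le> (\<sigma> * (\<tau> + 1) - 1) * (b \<bullet> b) + (\<sigma> - (\<tau> - 1)\<^sup>2) * (\<rho>' \<bullet> \<rho>')"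
    using sigma_const_times_ge[OF \<tau>] sigma_const_ge_square[OF \<tau>] sigma_const_discriminant[OF \<tau>]
    by (intro quadratic_form_nonneg) (simp_all add: \<kappa>_def)
  then have q: "\<beta> * (2 * (\<kappa> * (1 - \<tau>)) * (\<rho>' \<bullet> b))
      \<le> \<beta> * ((\<sigma> * (\<tau> + 1) - 1) * (b \<bullet> b) + (\<sigma> - (\<tau> - 1)\<^sup>2) * (\<rho>' \<bullet> \<rho>'))"
    using \<beta> by (intro mult_left_mono) auto
  have "2 * \<tau> * (\<sigma> * op_dist G (wt (Suc (Suc j))) (w (Suc j))
        - op_dist G (wt (Suc (Suc j))) (w (Suc (Suc j))) - \<eta>t (Suc (Suc j)))
      = \<sigma> * (2 * \<tau> * op_dist G (wt (Suc (Suc j))) (w (Suc j)))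
        - 2 * \<tau> * op_dist G (wt (Suc (Suc j))) (w (Suc (Suc j))) - 2 * \<tau> * \<eta>t (Suc (Suc j))"
    by (simp add: algebra_simps)
  also have "\<dots> = \<beta> * ((\<sigma> * (\<tau> + 1) - 1) * (b \<bullet> b))
      - \<kappa> * (2 * (u \<bullet> P u) + u \<bullet> T u + 2 * \<beta> * (\<rho> \<bullet> b))"
    unfolding D \<eta>2 by (simp add: \<kappa>_def nu_const_def power2_eq_square algebra_simps)
  also have "\<dots> \<ge> - (2 * \<tau> * \<eta>t (Suc j))"
    using z q \<eta>1 by (simp add: algebra_simps)
  finally have "0 \<le> 2 * \<tau> * (\<sigma> * op_dist G (wt (Suc (Suc j))) (w (Suc j))
        - op_dist G (wt (Suc (Suc j))) (w (Suc (Suc j))) - \<eta>t (Suc (Suc j)) + \<eta>t (Suc j))"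
    by (simp add: algebra_simps)
  then show ?thesis using \<tau>(1) by (simp add: zero_le_mult_iff)
qed

lemma G_step:
  "G (w i - w (Suc i)) = (S (y i - y (Suc i)), T' (z i - z (Suc i)), - r (Suc i))"
proof -
  have "inverse (\<tau> * \<beta>) * (\<tau> * \<beta>) = 1" using \<tau>(1) \<beta> by (intro left_inverse) simp
  then show ?thesis
    by (simp add: w_def G_def diag_op_def x_Suc del: inverse_mult_distrib)
qed

lemma inner_G_step_le:
  assumes "1 \<le> i"
  shows "G (w i - w (Suc i)) \<bullet> (wt (Suc i) - u) + (1 - \<sigma>) * op_dist G (wt (Suc i)) (w i)
    \<le> (op_dist G u (w i) + \<eta>t i) - (op_dist G u (w (Suc i)) + \<eta>t (Suc i))"
proof -
  obtain j where i: "i = Suc j" using assms by (cases i) auto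
  show ?thesis
    using relative_error[of j] op_dist_three_point[OF psd_G, of "w i" "w (Suc i)" "wt (Suc i)" u]
    by (simp add: i algebra_simps)
qed

text \<open>
  Both \<open>G (w i - w (Suc i))\<close> at \<open>wt (Suc i)\<close> and \<open>0\<close> at \<open>s\<close> belong to the KKT operator, whose
  skew-symmetric part drops out of the monotonicity inequality.
\<close>

lemma inner_G_step_ge:
  assumes "s \<in> kkt_points h p A B c"
  shows "2 * op_dist \<Sigma> s (w (Suc i)) \<le> G (w i - w (Suc i)) \<bullet> (wt (Suc i) - s)"
proof -
  obtain ys zs xs where s: "s = (ys, zs, xs)" by (cases s rule: prod_cases3)
  obtain v u where v: "v \<in> subdiff h ys" "0 = v + A xs" and u: "u \<in> subdiff p zs" "0 = u + B xs"
    and c: "c - adjoint A ys - adjoint B zs = 0"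
    using assms by (auto simp: s kkt_points_def kkt_op_def zero_prod_def)
  have vu: "v = - A xs" "u = - B xs" using v(2) u(2) by (simp_all add: eq_neg_iff_add_eq_0)
  define a b \<xi> where "a = y (Suc i) - ys" and "b = z (Suc i) - zs" and "\<xi> = xt (Suc i) - xs"
  have 1: "a \<bullet> H a \<le> (S (y i - y (Suc i)) - A \<xi>) \<bullet> a"
    using strong_mono_withD[OF h(1) H y_subgradient v(1), of i] by (simp add: a_def \<xi>_def vu linear_diff[OF A] diff_diff_eq2 diff_add_eq)
  have 2: "b \<bullet> P b \<le> (T' (z i - z (Suc i)) - B \<xi>) \<bullet> b"
    using strong_mono_withD[OF p(1) P z_subgradient u(1), of i] by (simp add: b_def \<xi>_def vu linear_diff[OF B] diff_diff_eq2 diff_add_eq)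
  have "r (Suc i) = adjoint A a + adjoint B b"
    unfolding r_def resid_def a_def b_def linear_diff[OF linear_adjoints(1)] linear_diff[OF linear_adjoints(2)]
    using c by (simp add: algebra_simps)
  then have 3: "A \<xi> \<bullet> a + B \<xi> \<bullet> b = r (Suc i) \<bullet> \<xi>"
    using adjoint_works[OF A, of \<xi> a] adjoint_works[OF B, of \<xi> b]
    by (simp add: inner_add_right inner_commute)
  have "2 * op_dist \<Sigma> s (w (Suc i)) = 2 * op_dist \<Sigma> (w (Suc i)) s"
    using op_dist_commute[OF psd_\<Sigma>] by metis
  also have "\<dots> = a \<bullet> H a + b \<bullet> P b"
    by (simp add: op_dist_inner[OF psd_\<Sigma>]) (simp add: s w_def a_def b_def \<Sigma>_def diag_op_def)
  also have "\<dots> \<le> G (w i - w (Suc i)) \<bullet> (wt (Suc i) - s)"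
    using 1 2 3 unfolding G_step
    by (simp add: wt_def s a_def[symmetric] b_def[symmetric] \<xi>_def[symmetric] inner_diff_left)
  finally show ?thesis .
qed

text \<open>
  The quarter of the last step in the \<open>\<Sigma>\<close>-seminorm contained in \<open>\<eta>\<close> is at most
  \<open>op_dist \<Sigma> s (w (Suc i)) + op_dist \<Sigma> s (w i)\<close>. Of the two copies of
  \<open>op_dist \<Sigma> s (w (Suc i))\<close> that strong monotonicity provides, one pays for this and the other
  turns \<open>G\<close> into \<open>M\<close>.
\<close>

lemma fejer:
  assumes s: "s \<in> kkt_points h p A B c" and i: "1 \<le> i"
  shows "op_dist M s (w (Suc i)) + \<eta> (Suc i) + (1 - \<sigma>) * op_dist G (wt (Suc i)) (w i)
    \<le> op_dist M s (w i) + \<eta> i"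
proof -
  have "(op_norm \<Sigma> (w (Suc i) - w i))\<^sup>2 = 2 * op_dist \<Sigma> (w (Suc i)) (w i)" by (simp add: op_dist_def)
  also have "\<dots> \<le> 4 * op_dist \<Sigma> s (w (Suc i)) + 4 * op_dist \<Sigma> s (w i)"
    using op_dist_triangle[OF psd_\<Sigma>, of "w (Suc i)" "w i" s] op_dist_commute[OF psd_\<Sigma>, of "w (Suc i)" s]
    by simp
  finally have "\<eta> (Suc i) \<le> \<eta>t (Suc i) + op_dist \<Sigma> s (w (Suc i)) + op_dist \<Sigma> s (w i)"
    by (simp add: \<eta>_def)
  with inner_G_step_le[OF i, of s] inner_G_step_ge[OF s, of i] \<eta>t_le_\<eta>[of i] show ?thesis
    by (simp add: op_dist_M)
qed

section \<open>A priori bounds\<close>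

definition init_gap :: "'y \<times> 'z \<times> 'x \<Rightarrow> real" where
  "init_gap s = op_dist M s (w 0) + op_dist M (w 1) (w 0) + \<eta> 1"

context
  fixes s
  assumes s: "s \<in> kkt_points h p A B c"
begin

lemma fejer_bound:
  assumes "1 \<le> i"
  shows "op_dist M s (w i) + \<eta> i \<le> 2 * init_gap s"
  using assms
proof (induction i rule: dec_induct)
  case base
  have "op_dist M s (w 1) \<le> 2 * op_dist M s (w 0) + 2 * op_dist M (w 1) (w 0)"
    using op_dist_triangle[OF psd_M, of s "w 1" "w 0"] op_dist_commute[OF psd_M, of "w 0" "w 1"] by simp
  with \<eta>t_nonneg[of 1] \<eta>t_le_\<eta>[of 1] show ?case by (simp add: init_gap_def)
next
  case (step i)
  have "0 \<le> (1 - \<sigma>) * op_dist G (wt (Suc i)) (w i)"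
    using sigma_const_less_1[OF \<tau>] op_dist_nonneg by (intro mult_nonneg_nonneg) auto
  with fejer[OF s step(1)] step.IH show ?case by linarith
qed

lemma op_dist_G_solution: 
  assumes "1 \<le> i"
  shows "op_dist G s (w i) + \<eta>t i \<le> 2 * init_gap s"
  using fejer_bound[OF assms] op_dist_nonneg[of \<Sigma> s "w i"] \<eta>t_le_\<eta>[of i] by (simp add: op_dist_M)

text \<open>
  The term with factor \<open>1 - \<sigma>\<close> that the Fejer inequality leaves over.
\<close>

lemma op_dist_G_wt:
  assumes "1 \<le> i"
  shows "op_dist G (wt (Suc i)) (w i) \<le> 2 * init_gap s / (1 - \<sigma>)"
  using fejer[OF s assms] fejer_bound[OF assms] sigma_const_less_1[OF \<tau>] op_dist_nonneg[of M s "w (Suc i)"]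
    \<eta>t_nonneg[of "Suc i"] \<eta>t_le_\<eta>[of "Suc i"]
  by (simp add: le_divide_eq mult.commute)

text \<open>
  The constant comes from the path \<open>wt (Suc j)\<close>, \<open>w j\<close>, \<open>s\<close>, \<open>w i\<close>: its first leg contributes
  \<open>4 / (1 - \<sigma>)\<close>, the other two \<open>16\<close> and \<open>\<eta>t i\<close> another \<open>2\<close>, all in units of \<open>init_gap s\<close>.
\<close>

lemma op_dist_G_wt_w:
  assumes "1 \<le> i" "1 \<le> j"
  shows "op_dist G (wt (Suc j)) (w i) + \<eta>t i \<le> 2 * init_gap s * ((11 - 9 * \<sigma>) / (1 - \<sigma>))"
proof -
  have "op_dist G (w j) (w i) \<le> 2 * op_dist G s (w j) + 2 * op_dist G s (w i)"
    using op_dist_triangle[OF psd_G, of "w j" "w i" s] op_dist_commute[OF psd_G, of "w j" s] by simp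
  with op_dist_triangle[OF psd_G, of "wt (Suc j)" "w i" "w j"] op_dist_G_wt[OF assms(2)]
    op_dist_G_solution[OF assms(1)] op_dist_G_solution[OF assms(2)] \<eta>t_nonneg[of i] \<eta>t_nonneg[of j]
  have "op_dist G (wt (Suc j)) (w i) + \<eta>t i \<le> 2 * (2 * init_gap s / (1 - \<sigma>)) + 18 * init_gap s"
    using op_dist_nonneg[of G s "w i"] by linarith
  also have "\<dots> = 2 * init_gap s * ((11 - 9 * \<sigma>) / (1 - \<sigma>))"
    using sigma_const_less_1[OF \<tau>] by (simp add: field_simps)
  finally show ?thesis .
qed

lemma norm_G_w:
  assumes "1 \<le> i"
  shows "norm (G (w i)) \<le> 2 * sqrt (onorm G * init_gap s) + norm (G s)"
proof -
  have "onorm G \<ge> 0"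
    using psd_op_linear[OF psd_G] by (simp add: onorm_pos_le linear_conv_bounded_linear)
  have "(norm (G (w i - s)))\<^sup>2 \<le> onorm G * (2 * op_dist G s (w i))"
    using norm_psd_op_le[OF psd_G, of "w i - s"] op_dist_commute[OF psd_G, of s "w i"]
    by (simp add: op_dist_inner[OF psd_G])
  also have "\<dots> \<le> onorm G * (4 * init_gap s)"
    using op_dist_G_solution[OF assms] \<eta>t_nonneg[of i] \<open>onorm G \<ge> 0\<close> by (intro mult_left_mono) auto
  finally have "norm (G (w i - s)) \<le> sqrt (4 * (onorm G * init_gap s))"
    by (intro real_le_rsqrt) (simp add: mult_ac)
  then have "norm (G (w i) - G s) \<le> 2 * sqrt (onorm G * init_gap s)"
    by (simp add: real_sqrt_mult linear_diff[OF psd_op_linear[OF psd_G]])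
  then show ?thesis using norm_triangle_sub[of "G (w i)" "G s"] by linarith
qed

end

section \<open>Ergodic averages\<close>

definition y_avg :: "(nat \<Rightarrow> real) \<Rightarrow> nat \<Rightarrow> 'y" where
  "y_avg \<alpha> k = (\<Sum>i=1..k. \<alpha> (Suc i) *\<^sub>R y (Suc i))"

definition z_avg :: "(nat \<Rightarrow> real) \<Rightarrow> nat \<Rightarrow> 'z" where
  "z_avg \<alpha> k = (\<Sum>i=1..k. \<alpha> (Suc i) *\<^sub>R z (Suc i))"

definition x_avg :: "(nat \<Rightarrow> real) \<Rightarrow> nat \<Rightarrow> 'x" where
  "x_avg \<alpha> k = (\<Sum>i=1..k. \<alpha> (Suc i) *\<^sub>R xt (Suc i))"

definition \<epsilon>y :: "(nat \<Rightarrow> real) \<Rightarrow> nat \<Rightarrow> real" where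
  "\<epsilon>y \<alpha> k = (\<Sum>i=1..k. \<alpha> (Suc i)
     * ((y (Suc i) - y_avg \<alpha> k) \<bullet> (S (y i - y (Suc i)) - A (xt (Suc i)))))"

definition \<epsilon>z :: "(nat \<Rightarrow> real) \<Rightarrow> nat \<Rightarrow> real" where
  "\<epsilon>z \<alpha> k = (\<Sum>i=1..k. \<alpha> (Suc i)
     * ((z (Suc i) - z_avg \<alpha> k) \<bullet> (T' (z i - z (Suc i)) - B (xt (Suc i)))))"

context
  fixes \<alpha> :: "nat \<Rightarrow> real" and k :: nat
  assumes \<alpha>: "\<And>i. i \<in> {1..k+1} \<Longrightarrow> 0 \<le> \<alpha> i" "\<alpha> 1 = 0" "(\<Sum>i=1..k. \<alpha> (Suc i)) = 1"
begin

lemma \<alpha>_nonneg: "i \<in> {1..k} \<Longrightarrow> 0 \<le> \<alpha> (Suc i)" "0 \<le> \<alpha> (Suc k)"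
  using \<alpha>(1) by auto

lemma ergodic_subgradients:
  shows \<epsilon>y_nonneg: "0 \<le> \<epsilon>y \<alpha> k" and \<epsilon>z_nonneg: "0 \<le> \<epsilon>z \<alpha> k"
    and "(\<Sum>i=1..k. \<alpha> (Suc i) *\<^sub>R S (y i - y (Suc i))) \<in> (\<lambda>v. v + A (x_avg \<alpha> k)) ` eps_subdiff (\<epsilon>y \<alpha> k) h (y_avg \<alpha> k)"
    and "(\<Sum>i=1..k. \<alpha> (Suc i) *\<^sub>R T' (z i - z (Suc i))) \<in> (\<lambda>v. v + B (x_avg \<alpha> k)) ` eps_subdiff (\<epsilon>z \<alpha> k) p (z_avg \<alpha> k)"
proof -
  note ay = subgradient_averages[where u = "\<lambda>i. y (Suc i)", OF h _ \<alpha>_nonneg(1) \<alpha>(3) y_subgradient,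
      folded y_avg_def, folded \<epsilon>y_def]
  note az = subgradient_averages[where u = "\<lambda>i. z (Suc i)", OF p _ \<alpha>_nonneg(1) \<alpha>(3) z_subgradient,
      folded z_avg_def, folded \<epsilon>z_def]
  show "0 \<le> \<epsilon>y \<alpha> k" "0 \<le> \<epsilon>z \<alpha> k" using ay(1) az(1) by auto
  show "(\<Sum>i=1..k. \<alpha> (Suc i) *\<^sub>R S (y i - y (Suc i))) \<in> (\<lambda>v. v + A (x_avg \<alpha> k)) ` eps_subdiff (\<epsilon>y \<alpha> k) h (y_avg \<alpha> k)"
    by (rule image_eqI[OF _ ay(2)])
      (simp_all add: x_avg_def linear_sum[OF A] linear_scale[OF A] scaleR_diff_right sum_subtractf)
  show "(\<Sum>i=1..k. \<alpha> (Suc i) *\<^sub>R T' (z i - z (Suc i))) \<in> (\<lambda>v. v + B (x_avg \<alpha> k)) ` eps_subdiff (\<epsilon>z \<alpha> k) p (z_avg \<alpha> k)"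
    by (rule image_eqI[OF _ az(2)])
      (simp_all add: x_avg_def linear_sum[OF B] linear_scale[OF B] scaleR_diff_right sum_subtractf)
qed

lemma resid_average: "resid A B c (y_avg \<alpha> k) (z_avg \<alpha> k) = (\<Sum>i=1..k. \<alpha> (Suc i) *\<^sub>R r (Suc i))"
proof -
  have "c = (\<Sum>i=1..k. \<alpha> (Suc i) *\<^sub>R c)" using \<alpha>(3) by (simp flip: scaleR_left.sum)
  then show ?thesis
    by (simp add: resid_def r_def y_avg_def z_avg_def linear_sum linear_scale linear_adjoints
        scaleR_diff_right scaleR_add_right sum_subtractf sum.distrib)
qed

lemma wt_average: "(\<Sum>i=1..k. \<alpha> (Suc i) *\<^sub>R wt (Suc i)) = (y_avg \<alpha> k, z_avg \<alpha> k, x_avg \<alpha> k)"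
  by (simp add: wt_def y_avg_def z_avg_def x_avg_def prod_eq_iff fst_sum snd_sum)

text \<open>
  The parts \<open>A (xt (Suc i))\<close> and \<open>B (xt (Suc i))\<close> of the two errors combine to the covariance of the
  residuals with the multipliers. A covariance may be centred in either variable; centring the
  multipliers instead of the residuals produces the third block of \<open>G (w i - w (Suc i))\<close>.
\<close>

lemma \<epsilon>_sum: "\<epsilon>y \<alpha> k + \<epsilon>z \<alpha> k
    = (\<Sum>i=1..k. \<alpha> (Suc i) * (G (w i - w (Suc i)) \<bullet> (wt (Suc i) - (y_avg \<alpha> k, z_avg \<alpha> k, x_avg \<alpha> k))))"
proof -
  define rbar where "rbar = resid A B c (y_avg \<alpha> k) (z_avg \<alpha> k)"
  have r_dev: "A u \<bullet> (y (Suc i) - (y_avg \<alpha> k)) + B u \<bullet> (z (Suc i) - (z_avg \<alpha> k)) = (r (Suc i) - rbar) \<bullet> u" for i u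
    using adjoint_works[OF A, of u "y (Suc i) - (y_avg \<alpha> k)"] adjoint_works[OF B, of u "z (Suc i) - (z_avg \<alpha> k)"]
    by (simp add: rbar_def r_def resid_def linear_diff linear_adjoints inner_add_right inner_diff_left
        inner_diff_right inner_commute)
  have "\<epsilon>y \<alpha> k + \<epsilon>z \<alpha> k = (\<Sum>i=1..k. \<alpha> (Suc i) * (S (y i - y (Suc i)) \<bullet> (y (Suc i) - (y_avg \<alpha> k))
      + T' (z i - z (Suc i)) \<bullet> (z (Suc i) - (z_avg \<alpha> k)) - (r (Suc i) - rbar) \<bullet> xt (Suc i)))"
    unfolding \<epsilon>y_def \<epsilon>z_def sum.distrib[symmetric] distrib_left[symmetric] r_dev[symmetric]
    by (simp add: inner_diff_right inner_commute algebra_simps)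
  also have "\<dots> = (\<Sum>i=1..k. \<alpha> (Suc i) * (S (y i - y (Suc i)) \<bullet> (y (Suc i) - (y_avg \<alpha> k))
      + T' (z i - z (Suc i)) \<bullet> (z (Suc i) - (z_avg \<alpha> k)) - r (Suc i) \<bullet> xt (Suc i)))
      + rbar \<bullet> (\<Sum>i=1..k. \<alpha> (Suc i) *\<^sub>R xt (Suc i))"
    by (simp add: inner_sum_right inner_diff_left algebra_simps flip: sum.distrib)
  also have "rbar \<bullet> (\<Sum>i=1..k. \<alpha> (Suc i) *\<^sub>R xt (Suc i)) = (\<Sum>i=1..k. \<alpha> (Suc i) *\<^sub>R r (Suc i)) \<bullet> (x_avg \<alpha> k)"
    by (simp add: rbar_def resid_average x_avg_def)
  also have "(\<Sum>i=1..k. \<alpha> (Suc i) * (S (y i - y (Suc i)) \<bullet> (y (Suc i) - (y_avg \<alpha> k))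
      + T' (z i - z (Suc i)) \<bullet> (z (Suc i) - (z_avg \<alpha> k)) - r (Suc i) \<bullet> xt (Suc i))) + \<dots>
      = (\<Sum>i=1..k. \<alpha> (Suc i) * (G (w i - w (Suc i)) \<bullet> (wt (Suc i) - (y_avg \<alpha> k, z_avg \<alpha> k, x_avg \<alpha> k))))"
    unfolding inner_sum_left sum.distrib[symmetric]
    by (intro sum.cong refl) (simp add: G_step wt_def inner_diff_right algebra_simps)
  finally show ?thesis .
qed

text \<open>
  Use the telescoping bound with the average itself as the reference point. Summation by parts then
  leaves \<open>q\<close> weighted with differences of the \<open>\<alpha>\<close>, and \<open>q\<close> is bounded because the average lies in every
  \<open>G\<close>-ball that contains all \<open>wt (Suc j)\<close>.
\<close>

lemma \<epsilon>_bound: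
  assumes s: "s \<in> kkt_points h p A B c"
  shows "\<epsilon>y \<alpha> k + \<epsilon>z \<alpha> k \<le> 2 * init_gap s * ((11 - 9 * \<sigma>) / (1 - \<sigma>)) * (\<Sum>i=1..k. \<bar>\<alpha> (Suc i) - \<alpha> i\<bar>)"
proof -
  define K where "K = 2 * init_gap s * ((11 - 9 * \<sigma>) / (1 - \<sigma>))"
  define u where "u = (y_avg \<alpha> k, z_avg \<alpha> k, x_avg \<alpha> k)"
  define q where "q i = op_dist G u (w i) + \<eta>t i" for i
  have q_nonneg: "0 \<le> q i" for i
    unfolding q_def by (intro add_nonneg_nonneg op_dist_nonneg \<eta>t_nonneg)
  have q_le: "q i \<le> K" if "1 \<le> i" for i
  proof -
    have "op_dist G (\<Sum>j=1..k. \<alpha> (Suc j) *\<^sub>R wt (Suc j)) (w i) \<le> K - \<eta>t i"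
      using op_dist_G_wt_w[OF s that]
      by (intro op_dist_convex_comb_le psd_G \<alpha>_nonneg \<alpha>) (auto simp: K_def le_diff_eq)
    then show ?thesis unfolding wt_average by (simp add: q_def u_def)
  qed
  have "\<epsilon>y \<alpha> k + \<epsilon>z \<alpha> k \<le> (\<Sum>i=1..k. \<alpha> (Suc i) *\<^sub>R (q i - q (Suc i)))"
    unfolding \<epsilon>_sum real_scaleR_def
  proof (intro sum_mono mult_left_mono \<alpha>_nonneg)
    fix i assume "i \<in> {1..k}"
    moreover have "0 \<le> (1 - \<sigma>) * op_dist G (wt (Suc i)) (w i)"
      using sigma_const_less_1[OF \<tau>] op_dist_nonneg by (intro mult_nonneg_nonneg) auto
    ultimately show "G (w i - w (Suc i)) \<bullet> (wt (Suc i) - (y_avg \<alpha> k, z_avg \<alpha> k, x_avg \<alpha> k)) \<le> q i - q (Suc i)"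
      using inner_G_step_le[of i u] by (simp add: q_def u_def)
  qed
  also have "\<dots> = (\<Sum>i=1..k. (\<alpha> (Suc i) - \<alpha> i) *\<^sub>R q i) - \<alpha> (Suc k) *\<^sub>R q (Suc k)"
    by (rule sum_by_parts) (rule \<alpha>(2))
  also have "\<dots> \<le> (\<Sum>i=1..k. (\<alpha> (Suc i) - \<alpha> i) *\<^sub>R q i)"
    using \<alpha>_nonneg(2) q_nonneg by simp
  also have "\<dots> \<le> (\<Sum>i=1..k. \<bar>\<alpha> (Suc i) - \<alpha> i\<bar> * K)"
    using q_nonneg q_le by (intro sum_mono) (auto intro: mult_mono)
  also have "\<dots> = K * (\<Sum>i=1..k. \<bar>\<alpha> (Suc i) - \<alpha> i\<bar>)"
    by (simp add: sum_distrib_left mult.commute)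
  finally show ?thesis by (simp only: K_def)
qed

lemma norm_average_G_step:
  assumes s: "s \<in> kkt_points h p A B c"
  shows "norm (\<Sum>i=1..k. \<alpha> (Suc i) *\<^sub>R G (w i - w (Suc i)))
    \<le> (2 * sqrt (onorm G * init_gap s) + norm (G s)) * ((\<Sum>i=1..k. \<bar>\<alpha> (Suc i) - \<alpha> i\<bar>) + \<alpha> (Suc k))"
proof -
  define C where "C = 2 * sqrt (onorm G * init_gap s) + norm (G s)"
  have "(\<Sum>i=1..k. \<alpha> (Suc i) *\<^sub>R G (w i - w (Suc i)))
      = (\<Sum>i=1..k. (\<alpha> (Suc i) - \<alpha> i) *\<^sub>R G (w i)) - \<alpha> (Suc k) *\<^sub>R G (w (Suc k))"
    unfolding linear_diff[OF psd_op_linear[OF psd_G]] by (rule sum_by_parts) (rule \<alpha>(2))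
  also have "norm \<dots> \<le> (\<Sum>i=1..k. \<bar>\<alpha> (Suc i) - \<alpha> i\<bar> * norm (G (w i))) + \<alpha> (Suc k) * norm (G (w (Suc k)))"
    using norm_triangle_ineq4 norm_sum \<alpha>_nonneg(2)
    by (intro order_trans[OF norm_triangle_ineq4] add_mono order_trans[OF norm_sum]) auto
  also have "\<dots> \<le> (\<Sum>i=1..k. \<bar>\<alpha> (Suc i) - \<alpha> i\<bar> * C) + \<alpha> (Suc k) * C"
    using norm_G_w[OF s] \<alpha>_nonneg(2) by (intro add_mono sum_mono mult_left_mono) (auto simp: C_def)
  also have "\<dots> = C * ((\<Sum>i=1..k. \<bar>\<alpha> (Suc i) - \<alpha> i\<bar>) + \<alpha> (Suc k))"
    by (simp add: sum_distrib_left algebra_simps)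
  finally show ?thesis by (simp only: C_def)
qed

lemma average_G_step:
  "(\<Sum>i=1..k. \<alpha> (Suc i) *\<^sub>R G (w i - w (Suc i)))
    = (\<Sum>i=1..k. \<alpha> (Suc i) *\<^sub>R S (y i - y (Suc i)), \<Sum>i=1..k. \<alpha> (Suc i) *\<^sub>R T' (z i - z (Suc i)),
       - resid A B c (y_avg \<alpha> k) (z_avg \<alpha> k))"
  by (simp add: G_step resid_average prod_eq_iff fst_sum snd_sum sum_negf)

text \<open>
  The first two blocks of the average of \<open>G (w i - w (Suc i))\<close> are members of the two sets, and its last
  block is minus the averaged residual.
\<close>

lemma residual_bound:
  assumes s: "s \<in> kkt_points h p A B c"
  shows "(edist 0 ((\<lambda>v. v + A (x_avg \<alpha> k)) ` eps_subdiff (\<epsilon>y \<alpha> k) h (y_avg \<alpha> k)))\<^sup>2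
    + (edist 0 ((\<lambda>v. v + B (x_avg \<alpha> k)) ` eps_subdiff (\<epsilon>z \<alpha> k) p (z_avg \<alpha> k)))\<^sup>2
    + ereal ((norm (resid A B c (y_avg \<alpha> k) (z_avg \<alpha> k)))\<^sup>2)
    \<le> ereal ((2 * sqrt (onorm G * init_gap s) + norm (G s))\<^sup>2
      * ((\<Sum>i=1..k. \<bar>\<alpha> (Suc i) - \<alpha> i\<bar>) + \<alpha> (Suc k))\<^sup>2)"
proof -
  define a where "a = (\<Sum>i=1..k. \<alpha> (Suc i) *\<^sub>R S (y i - y (Suc i)))"
  define b where "b = (\<Sum>i=1..k. \<alpha> (Suc i) *\<^sub>R T' (z i - z (Suc i)))"
  have "(edist 0 ((\<lambda>v. v + A (x_avg \<alpha> k)) ` eps_subdiff (\<epsilon>y \<alpha> k) h (y_avg \<alpha> k)))\<^sup>2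
      + (edist 0 ((\<lambda>v. v + B (x_avg \<alpha> k)) ` eps_subdiff (\<epsilon>z \<alpha> k) p (z_avg \<alpha> k)))\<^sup>2
      + ereal ((norm (resid A B c (y_avg \<alpha> k) (z_avg \<alpha> k)))\<^sup>2)
      \<le> ereal ((norm a)\<^sup>2) + ereal ((norm b)\<^sup>2) + ereal ((norm (resid A B c (y_avg \<alpha> k) (z_avg \<alpha> k)))\<^sup>2)"
    using ergodic_subgradients(3,4) unfolding a_def b_def
    by (intro add_mono edist_0_sq_le order_refl)
  also have "\<dots> = ereal ((norm (a, b, - resid A B c (y_avg \<alpha> k) (z_avg \<alpha> k)))\<^sup>2)"
    by (simp add: norm_prod_def)
  also have "\<dots> \<le> ereal (((2 * sqrt (onorm G * init_gap s) + norm (G s))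
      * ((\<Sum>i=1..k. \<bar>\<alpha> (Suc i) - \<alpha> i\<bar>) + \<alpha> (Suc k)))\<^sup>2)"
    using norm_average_G_step[OF s] unfolding average_G_step a_def[symmetric] b_def[symmetric]
    by (simp del: power_mult_distrib add: power_mono)
  finally show ?thesis by (simp add: power_mult_distrib)
qed

end

end

section \<open>The ergodic convergence bounds\<close>

theorem theorem2p1:
  fixes \<theta> :: "'y::euclidean_space \<Rightarrow> ereal" and \<phi> :: "'z::euclidean_space \<Rightarrow> ereal"
    and f :: "'y \<Rightarrow> real" and g :: "'z \<Rightarrow> real"
    and \<theta>f :: "'y \<Rightarrow> ereal" and \<phi>g :: "'z \<Rightarrow> ereal"
    and A :: "'x::euclidean_space \<Rightarrow> 'y" and B :: "'x \<Rightarrow> 'z" and c :: 'x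
    and \<beta> \<tau> :: real
    and S \<Sigma>\<theta> :: "'y \<Rightarrow> 'y" and T \<Sigma>\<phi> :: "'z \<Rightarrow> 'z"
    and \<Sigma> G M :: "'y \<times> 'z \<times> 'x \<Rightarrow> 'y \<times> 'z \<times> 'x"
    and y :: "nat \<Rightarrow> 'y" and z :: "nat \<Rightarrow> 'z" and x xt :: "nat \<Rightarrow> 'x"
    and w :: "nat \<Rightarrow> 'y \<times> 'z \<times> 'x" and what :: "'y \<times> 'z \<times> 'x"
    and \<eta>t \<eta> :: "nat \<Rightarrow> real" and dstar d1 :: real
    and k :: nat and \<alpha> :: "nat \<Rightarrow> real"
    and ybar :: 'y and zbar :: 'z and xbar :: 'x
    and \<delta>y :: "nat \<Rightarrow> 'y" and \<delta>z :: "nat \<Rightarrow> 'z" and \<epsilon>y \<epsilon>z :: real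
  assumes "closed_proper_convex \<theta>" and "closed_proper_convex \<phi>"
    and "convex_on UNIV f" and "cont_diff f"
    and "convex_on UNIV g" and "cont_diff g"
    and "\<theta>f = (\<lambda>u. \<theta> u + ereal (f u))" and "\<phi>g = (\<lambda>v. \<phi> v + ereal (g v))"
    and "linear A" and "linear B"
    and "\<beta> > 0" and "0 < \<tau>" and "\<tau> < (1 + sqrt 5) / 2"
    and "psd_op S" and "psd_op T"
    and "psd_op \<Sigma>\<theta>" and "strong_mono_with \<theta>f \<Sigma>\<theta>"
    and "psd_op \<Sigma>\<phi>" and "strong_mono_with \<phi>g \<Sigma>\<phi>"
    and "kkt_points \<theta>f \<phi>g A B c \<noteq> {}"
    and "\<Sigma> = diag_op \<Sigma>\<theta> \<Sigma>\<phi> (\<lambda>u. 0)"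
    and "G = diag_op S (\<lambda>v. T v + \<beta> *\<^sub>R B (adjoint B v)) (\<lambda>u. inverse (\<tau> * \<beta>) *\<^sub>R u)"
    and "M = (\<lambda>u. G u + \<Sigma> u)"
    and "y 0 \<in> edom \<theta>" and "z 0 \<in> edom \<phi>"
    and "w = (\<lambda>i. (y i, z i, x i))"
    and "\<forall>i. spadmm_step \<theta>f \<phi>g A B c \<beta> \<tau> S T (w i) (w (i + 1))"
    and "\<forall>i\<ge>1. xt i = x (i - 1) + \<beta> *\<^sub>R resid A B c (y i) (z (i - 1))"
    and "\<forall>i\<ge>1. \<eta>t i =
           (sigma_const \<tau> - (\<tau> - 1)\<^sup>2) * \<beta> / (2 * \<tau>) * (norm (resid A B c (y i) (z i)))\<^sup>2
         + sigma_const \<tau> / 2 * (op_norm S (y i - y (i - 1)))\<^sup>2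
         + nu_const \<tau> / (2 * \<tau>) * (op_norm T (z i - z (i - 1)))\<^sup>2
         + (sigma_const \<tau> + \<tau> - 1) / \<tau> * (op_norm \<Sigma>\<phi> (z i - z (i - 1)))\<^sup>2"
    and "\<forall>i\<ge>1. \<eta> i = \<eta>t i + 1/4 * (op_norm \<Sigma> (w i - w (i - 1)))\<^sup>2"
    and "is_arg_min (\<lambda>u. op_dist M u (w 0)) (\<lambda>u. u \<in> kkt_points \<theta>f \<phi>g A B c) what"
    and "dstar = op_dist M what (w 0)"
    and "d1 = op_dist M (w 1) (w 0)"
    and "k \<ge> 1"
    and "\<forall>i\<in>{1..k+1}. \<alpha> i \<ge> 0" and "\<alpha> 1 = 0" and "(\<Sum>i=1..k. \<alpha> (i + 1)) = 1"
    and "ybar = (\<Sum>i=1..k. \<alpha> (i + 1) *\<^sub>R y (i + 1))"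
    and "zbar = (\<Sum>i=1..k. \<alpha> (i + 1) *\<^sub>R z (i + 1))"
    and "xbar = (\<Sum>i=1..k. \<alpha> (i + 1) *\<^sub>R xt (i + 1))"
    and "\<forall>i\<ge>1. \<delta>y (i + 1) = S (y i - y (i + 1))"
    and "\<forall>i\<ge>1. \<delta>z (i + 1) = T (z i - z (i + 1)) + \<beta> *\<^sub>R B (adjoint B (z i - z (i + 1)))"
    and "\<epsilon>y = (\<Sum>i=1..k. \<alpha> (i + 1) * ((y (i + 1) - ybar) \<bullet> (\<delta>y (i + 1) - A (xt (i + 1)))))"
    and "\<epsilon>z = (\<Sum>i=1..k. \<alpha> (i + 1) * ((z (i + 1) - zbar) \<bullet> (\<delta>z (i + 1) - B (xt (i + 1)))))"
  shows "\<epsilon>y \<ge> 0 \<and> \<epsilon>z \<ge> 0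
    \<and> \<epsilon>y + \<epsilon>z \<le> 2 * (dstar + d1 + \<eta> 1) * ((11 - 9 * sigma_const \<tau>) / (1 - sigma_const \<tau>))
                    * (\<Sum>i=1..k. \<bar>\<alpha> (i + 1) - \<alpha> i\<bar>)
    \<and> (edist 0 ((\<lambda>v. v + A xbar) ` eps_subdiff \<epsilon>y \<theta>f ybar))\<^sup>2
        + (edist 0 ((\<lambda>v. v + B xbar) ` eps_subdiff \<epsilon>z \<phi>g zbar))\<^sup>2
        + ereal ((norm (resid A B c ybar zbar))\<^sup>2)
      \<le> ereal ((2 * sqrt (onorm G * (dstar + d1 + \<eta> 1)) + norm (G what))\<^sup>2
                * ((\<Sum>i=1..k. \<bar>\<alpha> (i + 1) - \<alpha> i\<bar>) + \<alpha> (k + 1))\<^sup>2)"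
proof -
  have closed: "proper_fun \<theta>" "convex (epi \<theta>)" "proper_fun \<phi>" "convex (epi \<phi>)"
    using assms(1,2) by (auto simp: closed_proper_convex_def)
  interpret run: spadmm \<theta>f \<phi>g A B c \<beta> \<tau> S \<Sigma>\<theta> T \<Sigma>\<phi> y z x
  proof (rule spadmm.intro)
    show "proper_fun \<theta>f" "convex (epi \<theta>f)" "proper_fun \<phi>g" "convex (epi \<phi>g)"
      unfolding assms(7,8) by (intro proper_fun_add convex_epi_add closed assms(3,5))+
    show "z 0 \<in> edom \<phi>g"
      using assms(25) by (simp add: assms(8) edom_def)
    show "spadmm_step \<theta>f \<phi>g A B c \<beta> \<tau> S T (y i, z i, x i) (y (Suc i), z (Suc i), x (Suc i))" for i
      using assms(27) by (simp add: assms(26))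
  qed (fact assms)+
  have w: "w = run.w" by (simp add: assms(26) run.w_def fun_eq_iff)
  have G: "G = run.G" by (simp add: assms(22) run.G_def run.T'_def)
  have \<Sigma>: "\<Sigma> = run.\<Sigma>" by (simp add: assms(21) run.\<Sigma>_def)
  have M: "M = run.M" by (simp add: assms(23) run.M_def G \<Sigma>)
  have \<eta>: "\<eta> 1 = run.\<eta> 1"
    using assms(29)[rule_format, of 1] assms(30)[rule_format, of 1]
    unfolding run.\<eta>_def run.\<eta>t_def run.r_def w \<Sigma> by simp
  have what: "what \<in> kkt_points \<theta>f \<phi>g A B c"
    using assms(31) by (simp add: is_arg_min_def)
  have E: "dstar + d1 + \<eta> 1 = run.init_gap what"
    by (simp only: assms(32,33) run.init_gap_def M w \<eta>)
  have xt: "xt (Suc i) = run.xt (Suc i)" for i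
    using assms(28) by (simp add: run.xt_def)
  have \<alpha>: "0 \<le> \<alpha> i" if "i \<in> {1..k+1}" for i using assms(35) that by blast
  have \<alpha>_sum: "(\<Sum>i=1..k. \<alpha> (Suc i)) = 1" using assms(37) by simp
  note avg = \<alpha> assms(36) \<alpha>_sum
  have ybar: "run.y_avg \<alpha> k = ybar" by (simp add: run.y_avg_def assms(38))
  have zbar: "run.z_avg \<alpha> k = zbar" by (simp add: run.z_avg_def assms(39))
  have xbar: "run.x_avg \<alpha> k = xbar" by (simp add: run.x_avg_def assms(40) xt)
  have \<epsilon>y: "\<epsilon>y = run.\<epsilon>y \<alpha> k"
    unfolding run.\<epsilon>y_def ybar assms(43) using assms(41) by (intro sum.cong) (auto simp: xt)
  have \<epsilon>z: "\<epsilon>z = run.\<epsilon>z \<alpha> k"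
    unfolding run.\<epsilon>z_def zbar assms(44) using assms(42) by (intro sum.cong) (auto simp: xt run.T'_def)
  show ?thesis
    using run.\<epsilon>y_nonneg[OF avg] run.\<epsilon>z_nonneg[OF avg]
      run.\<epsilon>_bound[OF avg what] run.residual_bound[OF avg what, unfolded ybar zbar xbar]
    unfolding E G \<epsilon>y \<epsilon>z Suc_eq_plus1 by blast
qed

end
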